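(* With probability one there exists $n_0$ such that for every $n\ge n_0$ the function $\mathbb R^4\ni(\alpha',\mu'_\varepsilon,\theta_1',\theta_2')\mapsto Q_n(\mathbf Y_n;\alpha',\mu'_\varepsilon,\theta_1',\theta_2')$ has a unique global minimizer $(\hat\alpha_n,\hat\mu_{\varepsilon,n},\hat\theta_{1,n},\hat\theta_{2,n})$, given by $$\hat\alpha_n=\frac{(n-2)\sum^{*}Y_{k-1}Y_k-\sum^{*}Y_k\sum^{*}Y_{k-1}}{D_n},\quad\hat\mu_{\varepsilon,n}=\frac{\sum^{*}Y_{k-1}^2\sum^{*}Y_k-\sum^{*}Y_{k-1}\sum^{*}Y_{k-1}Y_k}{D_n},\quad\hat\theta_{i,n}=Y_{s_i}-\hat\alpha_nY_{s_i-1}-\hat\mu_{\varepsilon,n},$$ where $\sum^*$ denotes $\sum_{k=1,k\notin\{s_1,s_2\}}^n$ and $D_n=(n-2)\sum^*Y_{k-1}^2-(\sum^*Y_{k-1})^2$. Moreover, for every $(\alpha,\mu_\varepsilon,\theta_1,\theta_2)\in(0,1)\times(0,\infty)\times\mathbb N^2$, almost surely $\hat\alpha_n\to\alpha$, $\hat\mu_{\varepsilon,n}\to\mu_\varepsilon$ and $\hat\theta_{i,n}\to Y_{s_i}-\alpha Y_{s_i-1}-\mu_\varepsilon$, $i=1,2$.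
   Context: INAR(1) with two innovational outliers: Let $\alpha\in(0,1)$. Let $(\varepsilon_k)_{k\in\mathbb N}$ be i.i.d. non-negative integer-valued random variables with $\mathbb E\varepsilon_1^2<\infty$ and $\mathbb P(\varepsilon_1\ne 0)>0$; write $\mu_\varepsilon=\mathbb E\varepsilon_1$. For each $k\in\mathbb N$ let $(\xi_{k,j})_{j\in\mathbb N}$ be i.i.d. Bernoulli random variables with mean $\alpha$, these sequences being mutually independent and independent of $(\varepsilon_k)$. Fix known times $s_1\ne s_2$ in $\mathbb N$ and sizes $\theta_1,\theta_2\in\mathbb N$. Let $Y_0$ be a non-negative integer-valued random variable with $\mathbb E Y_0^2<\infty$, independent of all $\xi_{k,j},\varepsilon_k$, and $Y_k=\sum_{j=1}^{Y_{k-1}}\xi_{k,j}+\varepsilon_k+\delta_{k,s_1}\theta_1+\delta_{k,s_2}\theta_2$, $k\in\mathbb N$. Write $\mathbf Y_n=(Y_0,\dots,Y_n)$. For $n\ge\max(s_1,s_2)$, $$Q_n(\mathbf y_n;\alpha',\mu'_\varepsilon,\theta_1',\theta_2')=\sum_{\substack{k=1\\k\notin\{s_1,s_2\}}}^n(y_k-\alpha'y_{k-1}-\mu'_\varepsilon)^2+\sum_{i=1}^2(y_{s_i}-\alpha'y_{s_i-1}-\mu'_\varepsilon-\theta_i')^2 .$$ *)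

theory Defs
  imports "HOL-Probability.Probability"
begin

text \<open>Index set for the driving random variables of the INAR(1) model:
  the initial value Y0, the innovations eps_k and the Bernoulli counting
  variables xi_{k,j}.\<close>
datatype inar_idx = IY0 | IEps nat | IXi nat nat

text \<open>The INAR(1) process with two innovational outliers, as a function of
  a realisation of the driving variables.\<close>
fun inarY :: "(nat \<Rightarrow> nat \<Rightarrow> nat) \<Rightarrow> (nat \<Rightarrow> nat) \<Rightarrow> nat \<Rightarrow> nat \<Rightarrow> nat \<Rightarrow> nat \<Rightarrow> nat \<Rightarrow> nat \<Rightarrow> nat" where
  "inarY xi eps y0 s1 s2 t1 t2 0 = y0"
| "inarY xi eps y0 s1 s2 t1 t2 (Suc k) =
     (\<Sum>j=1..inarY xi eps y0 s1 s2 t1 t2 k. xi (Suc k) j) + eps (Suc k)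
     + (if Suc k = s1 then t1 else 0) + (if Suc k = s2 then t2 else 0)"

definition sumstar :: "nat \<Rightarrow> nat \<Rightarrow> nat \<Rightarrow> (nat \<Rightarrow> real) \<Rightarrow> real" where
  "sumstar n s1 s2 f = (\<Sum>k\<in>{1..n} - {s1, s2}. f k)"

definition Qn :: "nat \<Rightarrow> nat \<Rightarrow> nat \<Rightarrow> (nat \<Rightarrow> real) \<Rightarrow> real \<times> real \<times> real \<times> real \<Rightarrow> real" where
  "Qn n s1 s2 y p = (case p of (a, m, t1, t2) \<Rightarrow>
      sumstar n s1 s2 (\<lambda>k. (y k - a * y (k - 1) - m)\<^sup>2)
      + (y s1 - a * y (s1 - 1) - m - t1)\<^sup>2
      + (y s2 - a * y (s2 - 1) - m - t2)\<^sup>2)"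

definition Dn :: "nat \<Rightarrow> nat \<Rightarrow> nat \<Rightarrow> (nat \<Rightarrow> real) \<Rightarrow> real" where
  "Dn n s1 s2 y = (real n - 2) * sumstar n s1 s2 (\<lambda>k. (y (k - 1))\<^sup>2)
                  - (sumstar n s1 s2 (\<lambda>k. y (k - 1)))\<^sup>2"

definition alpha_hat :: "nat \<Rightarrow> nat \<Rightarrow> nat \<Rightarrow> (nat \<Rightarrow> real) \<Rightarrow> real" where
  "alpha_hat n s1 s2 y =
     ((real n - 2) * sumstar n s1 s2 (\<lambda>k. y (k - 1) * y k)
       - sumstar n s1 s2 (\<lambda>k. y k) * sumstar n s1 s2 (\<lambda>k. y (k - 1))) / Dn n s1 s2 y"

definition mu_hat :: "nat \<Rightarrow> nat \<Rightarrow> nat \<Rightarrow> (nat \<Rightarrow> real) \<Rightarrow> real" where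
  "mu_hat n s1 s2 y =
     (sumstar n s1 s2 (\<lambda>k. (y (k - 1))\<^sup>2) * sumstar n s1 s2 (\<lambda>k. y k)
       - sumstar n s1 s2 (\<lambda>k. y (k - 1)) * sumstar n s1 s2 (\<lambda>k. y (k - 1) * y k)) / Dn n s1 s2 y"

definition theta_hat :: "nat \<Rightarrow> nat \<Rightarrow> nat \<Rightarrow> (nat \<Rightarrow> real) \<Rightarrow> nat \<Rightarrow> real" where
  "theta_hat n s1 s2 y s = y s - alpha_hat n s1 s2 y * y (s - 1) - mu_hat n s1 s2 y"

end

theory Submission
  imports Defs
begin

text \<open>Write \<open>M\<^sub>k = Y\<^sub>k - \<alpha> Y\<^sub>k\<^sub>-\<^sub>1 - \<mu>\<close> for \<open>k\<close> outside \<open>{s1, s2}\<close>. These are martingale differences, and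
  the estimation error of \<open>\<alpha>\<close> is \<open>((n - 2) \<Sum> Y\<^sub>k\<^sub>-\<^sub>1 M\<^sub>k - \<Sum> Y\<^sub>k\<^sub>-\<^sub>1 \<Sum> M\<^sub>k) / D\<^sub>n\<close>, while that of \<open>\<mu>\<close> is the
  mean of the \<open>M\<^sub>k\<close> minus the error of \<open>\<alpha>\<close> times the mean of the \<open>Y\<^sub>k\<^sub>-\<^sub>1\<close>. So no ergodic theorem is needed: it
  suffices that \<open>\<Sum> M\<^sub>k\<close> and \<open>\<Sum> Y\<^sub>k\<^sub>-\<^sub>1 M\<^sub>k\<close> are \<open>o(n)\<close>, that \<open>\<Sum> Y\<^sub>k = O(n)\<close> (which follows by telescoping), and
  that \<open>D\<^sub>n\<close> is at least a positive multiple of \<open>n\<^sup>2\<close>. The first two are strong laws for martingale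
  differences, obtained after truncation from the boundedness of the second moments of \<open>Y\<^sub>k\<close>. For the last,
  \<open>Y\<close> is integer-valued and moves at each step with conditional probability bounded away from 0,
  hence moves linearly often, and every move contributes to the sample variance.\<close>

section \<open>A strong law for square-integrable martingale differences\<close>

lemma integrable_mult_of_squares:
  fixes f g :: "'a \<Rightarrow> real"
  assumes [measurable]: "f \<in> borel_measurable M" "g \<in> borel_measurable M"
    and "integrable M (\<lambda>x. (f x)\<^sup>2)" "integrable M (\<lambda>x. (g x)\<^sup>2)"
  shows "integrable M (\<lambda>x. f x * g x)"
proof (rule Bochner_Integration.integrable_bound)
  show "integrable M (\<lambda>x. (f x)\<^sup>2 + (g x)\<^sup>2)"
    using assms by simp
  have "\<bar>a * b\<bar> \<le> a\<^sup>2 + b\<^sup>2" for a b :: real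
  proof -
    have "0 \<le> (\<bar>a\<bar> - \<bar>b\<bar>)\<^sup>2" "0 \<le> a\<^sup>2" "0 \<le> b\<^sup>2"
      by auto
    moreover have "0 \<le> \<bar>a\<bar> * \<bar>b\<bar>"
      by simp
    ultimately show ?thesis
      unfolding power2_diff power2_abs abs_mult by linarith
  qed
  then show "AE x in M. norm (f x * g x) \<le> norm ((f x)\<^sup>2 + (g x)\<^sup>2)"
    by (intro AE_I2) (auto intro: order_trans)
qed measurable

lemma integrable_square_add:
  fixes f g :: "'a \<Rightarrow> real"
  assumes "f \<in> borel_measurable M" "g \<in> borel_measurable M"
    and "integrable M (\<lambda>x. (f x)\<^sup>2)" "integrable M (\<lambda>x. (g x)\<^sup>2)"
  shows "integrable M (\<lambda>x. (f x + g x)\<^sup>2)"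
  using assms(3,4) integrable_mult_of_squares[OF assms] 
  by (simp add: power2_sum mult.assoc)

text \<open>The martingale property is stated in its \<open>L\<^sup>2\<close> form:
  \<open>D k\<close>, the increment from time \<open>k\<close> to \<open>k + 1\<close>, is
  orthogonal to every square-integrable \<open>F k\<close>-measurable function. This replaces
  conditional expectations by plain integrals of products.\<close>

locale mart_diff = prob_space M
  for M :: "'w measure" +
  fixes F :: "nat \<Rightarrow> 'w measure" and D :: "nat \<Rightarrow> 'w \<Rightarrow> real"
  assumes sub: "\<And>k. subalgebra M (F k)"
    and mono: "\<And>k. sets (F k) \<subseteq> sets (F (Suc k))"
    and adapted: "\<And>k. D k \<in> borel_measurable (F (Suc k))"
    and square: "\<And>k. integrable M (\<lambda>\<omega>. (D k \<omega>)\<^sup>2)"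
    and orth: "\<And>k f. f \<in> borel_measurable (F k) \<Longrightarrow> integrable M (\<lambda>\<omega>. (f \<omega>)\<^sup>2) \<Longrightarrow>
      expectation (\<lambda>\<omega>. f \<omega> * D k \<omega>) = 0"
begin

lemma sub_mono: "k \<le> l \<Longrightarrow> subalgebra (F l) (F k)"
  using lift_Suc_mono_le[of "\<lambda>k. sets (F k)" k l] mono sub
  by (auto simp: subalgebra_def)

lemma measurable_D [measurable]: "D k \<in> borel_measurable M"
  using measurable_from_subalg[OF sub adapted] .

lemma measurable_F_mono: "f \<in> measurable (F k) N \<Longrightarrow> k \<le> l \<Longrightarrow> f \<in> measurable (F l) N"
  using measurable_from_subalg[OF sub_mono] by blast

lemma partial_sum_adapted: "m \<le> n \<Longrightarrow> (\<lambda>\<omega>. \<Sum>k<m. D k \<omega>) \<in> borel_measurable (F n)"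
  by (intro borel_measurable_sum) (auto intro: measurable_F_mono[OF adapted])

text \<open>The partial sums are stopped when they first leave the interval of radius \<open>c\<close>. The stopped
  process again has orthogonal increments, and at time \<open>n\<close> it remembers whether the exit occurred,
  so Chebyshev's inequality for it bounds the running maximum.\<close>

lemma maximal_inequality:
  assumes "0 < c"
  shows "prob {\<omega>\<in>space M. \<exists>m\<le>n. c \<le> \<bar>\<Sum>k<m. D k \<omega>\<bar>} \<le> (\<Sum>k<n. expectation (\<lambda>\<omega>. (D k \<omega>)\<^sup>2)) / c\<^sup>2"
proof -
  define S where "S m \<omega> = (\<Sum>k<m. D k \<omega>)" for m \<omega>
  \<comment> \<open>\<open>J k\<close> tests for an exit only up to time \<open>k\<close>, so it is
    \<open>F k\<close>-measurable and may multiply \<open>D k\<close> without destroying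
    orthogonality. The increment that causes the exit is still added, and later ones are switched
    off.\<close>
  define J where "J k \<omega> = (if \<forall>m\<in>{..k}. \<bar>S m \<omega>\<bar> < c then 1 else 0 :: real)" for k \<omega>
  define U where "U m \<omega> = (\<Sum>k<m. J k \<omega> * D k \<omega>)" for m \<omega>
  have S_Suc: "S (Suc m) \<omega> = S m \<omega> + D m \<omega>" and U_Suc: "U (Suc m) \<omega> = U m \<omega> + J m \<omega> * D m \<omega>" for m \<omega>
    by (simp_all add: S_def U_def)
  have S_meas: "S m \<in> borel_measurable (F k)" if "m \<le> k" for m k
    using partial_sum_adapted[OF that] by (simp add: S_def[abs_def])
  have J_meas: "J k \<in> borel_measurable (F k)" for k
  proof -
    have "{\<omega>\<in>space (F k). \<forall>m\<in>{..k}. \<bar>S m \<omega>\<bar> < c} \<in> sets (F k)"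
    proof (rule sets.sets_Collect_finite_All)
      fix m assume "m \<in> {..k}"
      then have [measurable]: "S m \<in> borel_measurable (F k)"
        by (simp add: S_meas)
      show "{\<omega>\<in>space (F k). \<bar>S m \<omega>\<bar> < c} \<in> sets (F k)"
        by measurable
    qed simp
    then show ?thesis
      unfolding J_def[abs_def] by (rule measurable_If[OF borel_measurable_const borel_measurable_const])
  qed
  have [measurable]: "J k \<in> borel_measurable M" "S k \<in> borel_measurable M" for k
    using measurable_from_subalg[OF sub J_meas] measurable_from_subalg[OF sub S_meas] by auto
  have U_meas: "U m \<in> borel_measurable (F m)" for m
    unfolding U_def[abs_def]
    by (intro borel_measurable_sum borel_measurable_times)
      (auto intro: measurable_F_mono[OF adapted] measurable_F_mono[OF J_meas])
  have [measurable]: "U m \<in> borel_measurable M" for m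
    using measurable_from_subalg[OF sub U_meas] .
  have JD: "integrable M (\<lambda>\<omega>. (J k \<omega> * D k \<omega>)\<^sup>2)" for k
    by (rule Bochner_Integration.integrable_bound[OF square[of k]])
      (auto simp: J_def)
  have U2: "integrable M (\<lambda>\<omega>. (U m \<omega>)\<^sup>2)" for m
    by (induction m) (auto simp: U_Suc U_def[of 0] intro!: integrable_square_add JD)
  have EU: "expectation (\<lambda>\<omega>. (U m \<omega>)\<^sup>2) \<le> (\<Sum>k<m. expectation (\<lambda>\<omega>. (D k \<omega>)\<^sup>2))" for m
  proof (induction m)
    case (Suc m)
    have UJ: "integrable M (\<lambda>\<omega>. (U m \<omega> * J m \<omega>)\<^sup>2)"
      by (rule Bochner_Integration.integrable_bound[OF U2[of m]]) (auto simp: J_def)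
    \<comment> \<open>The switch is moved to the side of the past: \<open>U m * J m\<close> is an
      admissible test function in \<open>orth\<close>.\<close>
    have cross: "expectation (\<lambda>\<omega>. (U m \<omega> * J m \<omega>) * D m \<omega>) = 0"
      using UJ by (intro orth borel_measurable_times U_meas J_meas) auto
    have cross_int: "integrable M (\<lambda>\<omega>. (U m \<omega> * J m \<omega>) * D m \<omega>)"
      by (intro integrable_mult_of_squares UJ square) auto
    have "expectation (\<lambda>\<omega>. (U (Suc m) \<omega>)\<^sup>2) = expectation (\<lambda>\<omega>. (U m \<omega>)\<^sup>2 + (J m \<omega> * D m \<omega>)\<^sup>2
        + 2 * ((U m \<omega> * J m \<omega>) * D m \<omega>))"
      by (intro arg_cong[of _ _ expectation] ext) (simp add: U_Suc power2_sum algebra_simps)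
    also have "\<dots> = expectation (\<lambda>\<omega>. (U m \<omega>)\<^sup>2) + expectation (\<lambda>\<omega>. (J m \<omega> * D m \<omega>)\<^sup>2)"
      using U2 JD cross cross_int by simp
    also have "expectation (\<lambda>\<omega>. (J m \<omega> * D m \<omega>)\<^sup>2) \<le> expectation (\<lambda>\<omega>. (D m \<omega>)\<^sup>2)"
      by (intro integral_mono JD square) (auto simp: J_def)
    finally show ?case
      using Suc by simp
  qed (simp add: U_def)
  have stop: "((\<forall>m\<le>n. \<bar>S m \<omega>\<bar> < c) \<longrightarrow> U n \<omega> = S n \<omega>) \<and> ((\<exists>m\<le>n. c \<le> \<bar>S m \<omega>\<bar>) \<longrightarrow> c \<le> \<bar>U n \<omega>\<bar>)" for n \<omega>
  proof (induction n)
    case 0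
    then show ?case
      using assms by (auto simp: U_def S_def)
  next
    case (Suc n)
    show ?case
    proof (cases "\<forall>m\<le>n. \<bar>S m \<omega>\<bar> < c")
      case True
      then have "U (Suc n) \<omega> = S (Suc n) \<omega>"
        using Suc by (simp add: U_Suc S_Suc J_def)
      with True show ?thesis
        by (metis le_Suc_eq not_le)
    next
      case False
      then have "U (Suc n) \<omega> = U n \<omega>"
        by (auto simp: U_Suc J_def)
      with False Suc show ?thesis
        by (metis le_Suc_eq not_le)
    qed
  qed
  have "prob {\<omega>\<in>space M. \<exists>m\<le>n. c \<le> \<bar>S m \<omega>\<bar>} \<le> prob {\<omega>\<in>space M. c \<le> \<bar>U n \<omega>\<bar>}"
    using stop by (intro finite_measure_mono) auto
  also have "\<dots> \<le> expectation (\<lambda>\<omega>. (U n \<omega>)\<^sup>2) / c\<^sup>2"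
    using second_moment_method[of "U n" c] U2 assms by simp
  also have "\<dots> \<le> (\<Sum>k<n. expectation (\<lambda>\<omega>. (D k \<omega>)\<^sup>2)) / c\<^sup>2"
    by (intro divide_right_mono EU) auto
  finally show ?thesis
    by (simp add: S_def)
qed

text \<open>Dyadic blocks: the maximal inequality up to time \<open>2 ^ Suc r\<close> at level
  \<open>\<eta> * 2 ^ r\<close> gives a bound of order \<open>(2 powr (\<beta> - 1)) ^ r\<close>,
  summable because \<open>\<beta> < 1\<close>. By Borel-Cantelli the running maximum is eventually
  below that level, which handles all \<open>n\<close> between \<open>2 ^ r\<close> and
  \<open>2 ^ Suc r\<close> at once.\<close>

lemma strong_law:
  assumes var: "\<And>k. expectation (\<lambda>\<omega>. (D k \<omega>)\<^sup>2) \<le> C * real (Suc k) powr \<beta>"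
    and "0 \<le> \<beta>" "\<beta> < 1"
  shows "AE \<omega> in M. (\<lambda>n. (\<Sum>k<n. D k \<omega>) / real n) \<longlonglongrightarrow> 0"
proof -
  define S where "S m \<omega> = (\<Sum>k<m. D k \<omega>)" for m \<omega>
  have [measurable]: "S m \<in> borel_measurable M" for m
    unfolding S_def by measurable
  \<comment> \<open>At \<open>k = 0\<close> the growth factor in \<open>var\<close> is 1, so the
    sign of \<open>C\<close> can be read off.\<close>
  have "0 \<le> expectation (\<lambda>\<omega>. (D 0 \<omega>)\<^sup>2)"
    by simp
  also have "\<dots> \<le> C"
    using var[of 0] by simp
  finally have "0 \<le> C" .
  have var_sum: "(\<Sum>k<n. expectation (\<lambda>\<omega>. (D k \<omega>)\<^sup>2)) \<le> C * real n powr (1 + \<beta>)" for n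
  proof -
    have "(\<Sum>k<n. expectation (\<lambda>\<omega>. (D k \<omega>)\<^sup>2)) \<le> (\<Sum>k<n. C * real n powr \<beta>)"
      using \<open>0 \<le> C\<close> assms(2)
      by (intro sum_mono order_trans[OF var] mult_left_mono powr_mono2) auto
    also have "\<dots> = C * real n powr (1 + \<beta>)"
      by (cases "n = 0") (auto simp: powr_add)
    finally show ?thesis .
  qed
  have ev: "AE \<omega> in M. eventually (\<lambda>r. \<forall>m\<le>2 ^ Suc r. \<bar>S m \<omega>\<bar> < \<eta> * 2 ^ r) sequentially"
    if "0 < \<eta>" for \<eta> :: real
  proof -
    define A where "A r = {\<omega>\<in>space M. \<exists>m\<le>2 ^ Suc r. \<eta> * 2 ^ r \<le> \<bar>S m \<omega>\<bar>}" for r :: nat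
    have [measurable]: "A r \<in> sets M" for r
      unfolding A_def by measurable
    have bound: "measure M (A r) \<le> C * 2 powr (1 + \<beta>) / \<eta>\<^sup>2 * (2 powr (\<beta> - 1)) ^ r" for r
    proof -
      have "measure M (A r) \<le> C * real (2 ^ Suc r) powr (1 + \<beta>) / (\<eta> * 2 ^ r)\<^sup>2"
        unfolding A_def S_def
        using that by (intro order_trans[OF maximal_inequality] divide_right_mono var_sum) auto
      also have "real (2 ^ Suc r) powr (1 + \<beta>) = 2 powr ((1 + r) * (1 + \<beta>))"
        by (subst powr_powr[symmetric]) (simp add: powr_realpow powr_add)
      also have "C * 2 powr ((1 + r) * (1 + \<beta>)) / (\<eta> * 2 ^ r)\<^sup>2
          = C / \<eta>\<^sup>2 * 2 powr ((1 + r) * (1 + \<beta>) - 2 * r)"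
      proof -
        have "2 powr (2 * real r) = ((2::real) ^ r)\<^sup>2"
          by (metis mult.commute of_nat_mult of_nat_numeral power_mult powr_realpow zero_less_numeral)
        then show ?thesis
          by (simp add: powr_diff power_mult_distrib)
      qed
      also have "(1 + r) * (1 + \<beta>) - 2 * r = (1 + \<beta>) + (\<beta> - 1) * r"
        by (simp add: algebra_simps)
      also have "2 powr ((1 + \<beta>) + (\<beta> - 1) * r) = 2 powr (1 + \<beta>) * (2 powr (\<beta> - 1)) ^ r"
        by (simp add: powr_add powr_powr powr_realpow[symmetric])
      finally show ?thesis
        by simp
    qed
    have "2 powr (\<beta> - 1) < (1 :: real)"
      using assms(3) by (simp add: powr_less_one)
    then have "summable (\<lambda>r. C * 2 powr (1 + \<beta>) / \<eta>\<^sup>2 * (2 powr (\<beta> - 1)) ^ r)"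
      by (intro summable_mult summable_geometric) auto
    then have "summable (\<lambda>r. measure M (A r))"
      by (rule summable_comparison_test') (use bound in auto)
    then have "AE \<omega> in M. eventually (\<lambda>r. \<omega> \<in> space M - A r) sequentially"
      by (intro borel_cantelli_AE1) (auto simp: less_top[symmetric])
    then show ?thesis
      by eventually_elim (auto elim!: eventually_mono simp: A_def simp flip: not_le)
  qed
  \<comment> \<open>Countably many levels suffice, so a single null set serves every positive
    level.\<close>
  have "AE \<omega> in M. \<forall>i. eventually (\<lambda>r. \<forall>m\<le>2 ^ Suc r. \<bar>S m \<omega>\<bar> < inverse (real (Suc i)) * 2 ^ r) sequentially"
    by (subst AE_all_countable) (auto intro!: ev simp del: power_Suc)
  then show ?thesis
  proof eventually_elim
    case (elim \<omega>)
    show ?case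
    proof (rule LIMSEQ_I)
      fix e :: real assume "0 < e"
      then obtain i where i: "inverse (real (Suc i)) < e"
        using reals_Archimedean by blast
      obtain R where R: "\<And>r m. R \<le> r \<Longrightarrow> m \<le> 2 ^ Suc r \<Longrightarrow> \<bar>S m \<omega>\<bar> < inverse (real (Suc i)) * 2 ^ r"
        using elim[rule_format, of i] by (auto simp: eventually_sequentially)
      have "norm ((\<Sum>k<n. D k \<omega>) / real n - 0) < e" if "2 ^ R \<le> n" for n
      proof -
        have "0 < n"
          using that by (metis less_le_trans pos2 zero_less_power)
        then obtain r where r: "2 ^ r \<le> n" "n < 2 ^ Suc r"
          using ex_power_ivl1[of 2 n] by auto
        have "2 ^ R < (2 :: nat) ^ Suc r"
          using that r by linarith
        then have "R \<le> r"
          by (subst (asm) power_strict_increasing_iff) auto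
        have "\<bar>S n \<omega>\<bar> < inverse (real (Suc i)) * 2 ^ r"
          using R[OF \<open>R \<le> r\<close>, of n] r by auto
        also have "(2::real) ^ r \<le> real n"
          using r(1) by (metis of_nat_le_iff of_nat_numeral of_nat_power)
        then have "inverse (real (Suc i)) * 2 ^ r \<le> e * n"
          using i \<open>0 < e\<close> by (intro mult_mono) auto
        finally show ?thesis
          using \<open>0 < n\<close> by (simp add: S_def field_simps)
      qed
      then show "\<exists>no. \<forall>n\<ge>no. norm ((\<Sum>k<n. D k \<omega>) / real n - 0) < e"
        by blast
    qed
  qed
qed

end

section \<open>Least squares\<close>

lemma sumstar_add: "sumstar n s1 s2 (\<lambda>k. f k + g k) = sumstar n s1 s2 f + sumstar n s1 s2 g"
  and sumstar_diff: "sumstar n s1 s2 (\<lambda>k. f k - g k) = sumstar n s1 s2 f - sumstar n s1 s2 g"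
  and sumstar_mult: "sumstar n s1 s2 (\<lambda>k. c * f k) = c * sumstar n s1 s2 f"
  and sumstar_nonneg: "(\<And>k. 0 \<le> f k) \<Longrightarrow> 0 \<le> sumstar n s1 s2 f"
  by (auto simp: sumstar_def sum.distrib sum_subtractf sum_distrib_left intro: sum_nonneg)

context
  fixes s1 s2 n :: nat
  assumes s: "1 \<le> s1" "1 \<le> s2" "s1 \<noteq> s2" and n: "s1 \<le> n" "s2 \<le> n"
begin

lemma sumstar_eq: "sumstar n s1 s2 f = (\<Sum>k=1..n. f k) - f s1 - f s2"
proof -
  have "sum f ({1..n} - {s1, s2}) = sum f {1..n} - sum f {s1, s2}"
    using s n by (intro sum_diff) auto
  then show ?thesis
    using s by (simp add: sumstar_def)
qed

lemma sumstar_const: "sumstar n s1 s2 (\<lambda>k. c) = (real n - 2) * c"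
  by (simp add: sumstar_eq algebra_simps)

text \<open>For trading the sum of the \<open>y k\<close> against that of the
  \<open>y (k - 1)\<close>: they differ only by boundary terms. This is what later bounds the sum of
  the \<open>y (k - 1)\<close> linearly.\<close>

lemma sumstar_telescope:
  "sumstar n s1 s2 (\<lambda>k. y k - y (k - 1)) = y n - y 0 - (y s1 - y (s1 - 1)) - (y s2 - y (s2 - 1))"
proof -
  have "(\<Sum>k=1..n. y k - y (k - 1)) = y n - y 0"
    using sum_telescope''[of 0 n y] by simp
  then show ?thesis
    by (simp add: sumstar_eq)
qed

text \<open>Completing the square in \<open>v\<close>. With parameter differences for
  \<open>u\<close> and \<open>v\<close> it yields uniqueness of the minimizer; with
  \<open>u = 1\<close> and \<open>v\<close> minus the mean it shows \<open>Dn\<close> to be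
  \<open>n - 2\<close> times the centred sum of squares.\<close>

lemma affine_square_sum:
  "(real n - 2) * sumstar n s1 s2 (\<lambda>k. (u * y (k - 1) + v)\<^sup>2)
    = u\<^sup>2 * Dn n s1 s2 y + (u * sumstar n s1 s2 (\<lambda>k. y (k - 1)) + (real n - 2) * v)\<^sup>2"
proof -
  have "sumstar n s1 s2 (\<lambda>k. (u * y (k - 1) + v)\<^sup>2)
      = sumstar n s1 s2 (\<lambda>k. u\<^sup>2 * (y (k - 1))\<^sup>2 + ((2 * u * v) * y (k - 1) + v\<^sup>2))"
    by (simp add: power2_eq_square algebra_simps)
  also have "\<dots> = u\<^sup>2 * sumstar n s1 s2 (\<lambda>k. (y (k - 1))\<^sup>2)
      + ((2 * u * v) * sumstar n s1 s2 (\<lambda>k. y (k - 1)) + (real n - 2) * v\<^sup>2)"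
    by (simp only: sumstar_add sumstar_mult sumstar_const)
  finally show ?thesis
    unfolding Dn_def by (simp only:) (simp add: power2_eq_square algebra_simps)
qed

text \<open>The two estimators are Cramer's rule for the linear system given by the normal
  equations, whose determinant is \<open>Dn\<close>. Multiplied by the determinant, each equation
  becomes a polynomial identity.\<close>

lemma normal_equations:
  assumes D: "Dn n s1 s2 y \<noteq> 0"
  defines "r \<equiv> \<lambda>k. y k - alpha_hat n s1 s2 y * y (k - 1) - mu_hat n s1 s2 y"
  shows "sumstar n s1 s2 r = 0" "sumstar n s1 s2 (\<lambda>k. y (k - 1) * r k) = 0"
proof -
  define N where "N = real n - 2"
  define SX where "SX = sumstar n s1 s2 (\<lambda>k. y (k - 1))"
  define SZ where "SZ = sumstar n s1 s2 y"
  define SXX where "SXX = sumstar n s1 s2 (\<lambda>k. (y (k - 1))\<^sup>2)"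
  define SXZ where "SXZ = sumstar n s1 s2 (\<lambda>k. y (k - 1) * y k)"
  note defs = N_def[symmetric] SX_def[symmetric] SZ_def[symmetric] SXX_def[symmetric] SXZ_def[symmetric]
  define a where "a = alpha_hat n s1 s2 y"
  define m where "m = mu_hat n s1 s2 y"
  define E where "E = Dn n s1 s2 y"
  have E: "E = N * SXX - SX\<^sup>2" "E \<noteq> 0"
    using D unfolding E_def Dn_def defs by simp_all
  have a: "a = (N * SXZ - SZ * SX) / E" and m: "m = (SXX * SZ - SX * SXZ) / E"
    unfolding a_def m_def E_def alpha_hat_def mu_hat_def defs by simp_all
  have aE: "a * E = N * SXZ - SZ * SX" and mE: "m * E = SXX * SZ - SX * SXZ"
    using E by (simp_all add: a m)
  have "sumstar n s1 s2 r = SZ - a * SX - N * m"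
    unfolding r_def a_def[symmetric] m_def[symmetric] SX_def SZ_def N_def
    by (simp add: sumstar_diff sumstar_mult sumstar_const)
  moreover have "E * (SZ - a * SX - N * m) = 0"
  proof -
    have "E * (SZ - a * SX - N * m) = E * SZ - (a * E) * SX - N * (m * E)"
      by (simp add: algebra_simps)
    then show ?thesis
      by (simp only: aE mE) (simp add: E(1) power2_eq_square algebra_simps)
  qed
  ultimately show "sumstar n s1 s2 r = 0"
    using E by simp
  have "sumstar n s1 s2 (\<lambda>k. y (k - 1) * r k)
      = sumstar n s1 s2 (\<lambda>k. y (k - 1) * y k - a * (y (k - 1))\<^sup>2 - m * y (k - 1))"
    by (simp add: r_def power2_eq_square algebra_simps flip: a_def m_def)
  also have "\<dots> = SXZ - a * SXX - m * SX"
    by (simp only: sumstar_diff sumstar_mult defs)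
  finally have "sumstar n s1 s2 (\<lambda>k. y (k - 1) * r k) = SXZ - a * SXX - m * SX" .
  moreover have "E * (SXZ - a * SXX - m * SX) = 0"
  proof -
    have "E * (SXZ - a * SXX - m * SX) = E * SXZ - (a * E) * SXX - (m * E) * SX"
      by (simp add: algebra_simps)
    then show ?thesis
      by (simp only: aE mE) (simp add: E(1) power2_eq_square algebra_simps)
  qed
  ultimately show "sumstar n s1 s2 (\<lambda>k. y (k - 1) * r k) = 0"
    using E by simp
qed

text \<open>The first normal equation solved for the intercept. In this form the denominator is
  \<open>n - 2\<close> instead of \<open>Dn\<close>, which suits the limit.\<close>

lemma mu_hat_eq:
  assumes "Dn n s1 s2 y \<noteq> 0" "2 < n"
  shows "mu_hat n s1 s2 y = (sumstar n s1 s2 y - alpha_hat n s1 s2 y * sumstar n s1 s2 (\<lambda>k. y (k - 1))) / (real n - 2)"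
proof -
  have "sumstar n s1 s2 y - alpha_hat n s1 s2 y * sumstar n s1 s2 (\<lambda>k. y (k - 1))
      - (real n - 2) * mu_hat n s1 s2 y = 0"
    using normal_equations(1)[OF assms(1)] by (simp add: sumstar_diff sumstar_mult sumstar_const)
  then show ?thesis
    using assms(2) by (simp add: eq_divide_eq mult.commute)
qed

text \<open>Pythagoras: by the normal equations the fitted residuals are orthogonal to constants and
  to the \<open>y (k - 1)\<close>, so the cross terms vanish. At the estimators the two outlier
  residuals are zero.\<close>

lemma Qn_decomposition:
  fixes a m t1 t2 :: real
  assumes D: "Dn n s1 s2 y \<noteq> 0"
  defines "ah \<equiv> alpha_hat n s1 s2 y" and "mh \<equiv> mu_hat n s1 s2 y"
  shows "Qn n s1 s2 y (a, m, t1, t2)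
    = Qn n s1 s2 y (ah, mh, theta_hat n s1 s2 y s1, theta_hat n s1 s2 y s2)
      + sumstar n s1 s2 (\<lambda>k. ((a - ah) * y (k - 1) + (m - mh))\<^sup>2)
      + (y s1 - a * y (s1 - 1) - m - t1)\<^sup>2 + (y s2 - a * y (s2 - 1) - m - t2)\<^sup>2"
proof -
  define r where "r k = y k - ah * y (k - 1) - mh" for k
  have "sumstar n s1 s2 (\<lambda>k. (y k - a * y (k - 1) - m)\<^sup>2)
      = sumstar n s1 s2 (\<lambda>k. (r k)\<^sup>2 + ((a - ah) * y (k - 1) + (m - mh))\<^sup>2
          - ((2 * (a - ah)) * (y (k - 1) * r k) + (2 * (m - mh)) * r k))"
    by (simp add: r_def power2_eq_square algebra_simps)
  also have "\<dots> = sumstar n s1 s2 (\<lambda>k. (r k)\<^sup>2)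
      + sumstar n s1 s2 (\<lambda>k. ((a - ah) * y (k - 1) + (m - mh))\<^sup>2)"
    using normal_equations[OF D]
    by (simp add: sumstar_add sumstar_diff sumstar_mult r_def[abs_def] ah_def mh_def)
  finally show ?thesis
    by (simp add: Qn_def theta_hat_def r_def flip: ah_def mh_def)
qed

text \<open>The excess over the value at \<open>p0\<close> is a sum of squares. If it vanishes, the
  completed square with \<open>Dn\<close> positive forces equality of the slopes, then
  \<open>n > 2\<close> that of the intercepts, and the last two squares that of the outlier
  sizes.\<close>

lemma Qn_unique_minimizer:
  assumes D: "0 < Dn n s1 s2 y" and n2: "2 < n"
  defines "p0 \<equiv> (alpha_hat n s1 s2 y, mu_hat n s1 s2 y, theta_hat n s1 s2 y s1, theta_hat n s1 s2 y s2)"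
  shows "(\<forall>q. Qn n s1 s2 y p0 \<le> Qn n s1 s2 y q)
    \<and> (\<forall>p. (\<forall>q. Qn n s1 s2 y p \<le> Qn n s1 s2 y q) \<longrightarrow> p = p0)"
proof (intro conjI allI impI)
  have D0: "Dn n s1 s2 y \<noteq> 0"
    using D by simp
  show "Qn n s1 s2 y p0 \<le> Qn n s1 s2 y q" for q
  proof -
    obtain a m t1 t2 where q: "q = (a, m, t1, t2)"
      by (cases q)
    have "0 \<le> sumstar n s1 s2 (\<lambda>k. ((a - alpha_hat n s1 s2 y) * y (k - 1) + (m - mu_hat n s1 s2 y))\<^sup>2)"
      by (simp add: sumstar_nonneg)
    then show ?thesis
      using Qn_decomposition[OF D0, of a m t1 t2] by (smt (verit) p0_def q zero_le_power2)
  qed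
  fix p assume min: "\<forall>q. Qn n s1 s2 y p \<le> Qn n s1 s2 y q"
  obtain a m t1 t2 where p: "p = (a, m, t1, t2)"
    by (cases p)
  define ah where "ah = alpha_hat n s1 s2 y"
  define mh where "mh = mu_hat n s1 s2 y"
  define L where "L = sumstar n s1 s2 (\<lambda>k. ((a - ah) * y (k - 1) + (m - mh))\<^sup>2)"
  have "0 \<le> L"
    by (simp add: L_def sumstar_nonneg)
  moreover have "L + (y s1 - a * y (s1 - 1) - m - t1)\<^sup>2 + (y s2 - a * y (s2 - 1) - m - t2)\<^sup>2 \<le> 0"
    using min[rule_format, of p0] Qn_decomposition[OF D0, of a m t1 t2]
    by (simp add: p p0_def L_def ah_def mh_def)
  ultimately have L: "L = 0" and t: "(y s1 - a * y (s1 - 1) - m - t1)\<^sup>2 = 0" "(y s2 - a * y (s2 - 1) - m - t2)\<^sup>2 = 0"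
    by (smt (verit) zero_le_power2)+
  have eq: "0 = (a - ah)\<^sup>2 * Dn n s1 s2 y + ((a - ah) * sumstar n s1 s2 (\<lambda>k. y (k - 1)) + (real n - 2) * (m - mh))\<^sup>2"
    using L affine_square_sum[of "a - ah" y "m - mh"] by (simp add: L_def)
  have "0 \<le> (a - ah)\<^sup>2 * Dn n s1 s2 y"
    using D by simp
  then have "(a - ah)\<^sup>2 * Dn n s1 s2 y = 0" and
    sq: "((a - ah) * sumstar n s1 s2 (\<lambda>k. y (k - 1)) + (real n - 2) * (m - mh))\<^sup>2 = 0"
    using eq by (smt (verit) zero_le_power2)+
  then have "a = ah"
    using D by simp
  with sq n2 have "m = mh"
    by simp
  with \<open>a = ah\<close> t show "p = p0"
    by (simp add: p p0_def theta_hat_def ah_def mh_def)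
qed

text \<open>Pure algebra, valid for any \<open>\<alpha>\<close> and \<open>\<mu>\<close>: on
  inserting \<open>y k = \<alpha> * y (k - 1) + \<mu> + residual\<close> in the numerator, the
  \<open>\<alpha>\<close> part is \<open>\<alpha> * Dn\<close> and the \<open>\<mu>\<close> parts
  cancel.\<close>

lemma alpha_hat_error:
  assumes "Dn n s1 s2 y \<noteq> 0"
  shows "alpha_hat n s1 s2 y - \<alpha>
    = ((real n - 2) * sumstar n s1 s2 (\<lambda>k. y (k - 1) * (y k - \<alpha> * y (k - 1) - \<mu>))
      - sumstar n s1 s2 (\<lambda>k. y k - \<alpha> * y (k - 1) - \<mu>) * sumstar n s1 s2 (\<lambda>k. y (k - 1))) / Dn n s1 s2 y"
proof -
  have "sumstar n s1 s2 (\<lambda>k. y (k - 1) * (y k - \<alpha> * y (k - 1) - \<mu>))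
      = sumstar n s1 s2 (\<lambda>k. y (k - 1) * y k - \<alpha> * (y (k - 1))\<^sup>2 - \<mu> * y (k - 1))"
    by (simp add: power2_eq_square algebra_simps)
  also have "\<dots> = sumstar n s1 s2 (\<lambda>k. y (k - 1) * y k) - \<alpha> * sumstar n s1 s2 (\<lambda>k. (y (k - 1))\<^sup>2)
      - \<mu> * sumstar n s1 s2 (\<lambda>k. y (k - 1))"
    by (simp only: sumstar_diff sumstar_mult)
  finally have B: "sumstar n s1 s2 (\<lambda>k. y (k - 1) * (y k - \<alpha> * y (k - 1) - \<mu>)) = \<dots>" .
  have A: "sumstar n s1 s2 (\<lambda>k. y k - \<alpha> * y (k - 1) - \<mu>)
      = sumstar n s1 s2 y - \<alpha> * sumstar n s1 s2 (\<lambda>k. y (k - 1)) - (real n - 2) * \<mu>"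
    by (simp add: sumstar_diff sumstar_mult sumstar_const)
  have "alpha_hat n s1 s2 y - \<alpha> = ((real n - 2) * sumstar n s1 s2 (\<lambda>k. y (k - 1) * y k)
      - sumstar n s1 s2 y * sumstar n s1 s2 (\<lambda>k. y (k - 1)) - \<alpha> * Dn n s1 s2 y) / Dn n s1 s2 y"
    using assms by (simp add: alpha_hat_def diff_divide_distrib)
  then show ?thesis
    unfolding A B by (simp add: Dn_def power2_eq_square algebra_simps)
qed

text \<open>Any centre \<open>c\<close> is at distance at least \<open>1/2\<close> from one of two distinct consecutive values of an
  integer sequence, so the sample variance is at least a constant times the number of moves.\<close>

lemma Dn_lower_bound:
  fixes z :: "nat \<Rightarrow> nat"
  assumes "2 < n"
  shows "(real n - 2) * (sumstar n s1 s2 (\<lambda>k. if z k \<noteq> z (k - 1) then 1 else 0) - 3) / 4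
    \<le> Dn n s1 s2 (\<lambda>k. real (z k))"
proof -
  define y where "y k = real (z k)" for k
  define c where "c = sumstar n s1 s2 (\<lambda>k. y (k - 1)) / (real n - 2)"
  define S where "S = {1..n} - {s1, s2}"
  define mv where "mv k = (if z k \<noteq> z (k - 1) then 1 else 0 :: real)" for k
  \<comment> \<open>\<open>A\<close> keeps those \<open>k\<close> in \<open>S\<close> for which
    \<open>k + 1\<close> lies in \<open>S\<close> as well, so that both \<open>y (k - 1)\<close> and
    \<open>y k\<close> occur as lagged values in the sample variance. At most three indices are
    lost, hence the 3 in the bound.\<close>
  define A where "A = S - {s1 - 1, s2 - 1, n}"
  have A: "A \<subseteq> S" "Suc ` A \<subseteq> S" "finite S"
    using s by (auto simp: A_def S_def)
  have "Dn n s1 s2 y = (real n - 2) * sumstar n s1 s2 (\<lambda>k. (y (k - 1) - c)\<^sup>2)"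
    using affine_square_sum[of 1 y "- c"] assms by (simp add: c_def)
  moreover have "(\<Sum>k\<in>S. mv k) - 3 \<le> 4 * (\<Sum>k\<in>S. (y (k - 1) - c)\<^sup>2)"
  proof -
    have "(\<Sum>k\<in>S. mv k) \<le> (\<Sum>k\<in>A \<union> {s1 - 1, s2 - 1, n}. mv k)"
      using A by (intro sum_mono2) (auto simp: A_def mv_def)
    also have "\<dots> \<le> (\<Sum>k\<in>A. mv k) + (\<Sum>k\<in>{s1 - 1, s2 - 1, n}. mv k)"
      using A by (subst sum.union_disjoint) (auto simp: A_def finite_subset)
    also have "(\<Sum>k\<in>{s1 - 1, s2 - 1, n}. mv k) \<le> of_nat (card {s1 - 1, s2 - 1, n}) * 1"
      by (intro sum_bounded_above) (auto simp: mv_def)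
    also have "\<dots> \<le> 3"
      using card_insert_le_m1[of 3 "{s2 - 1, n}" "s1 - 1"] card_insert_le_m1[of 2 "{n}" "s2 - 1"] by simp
    finally have "(\<Sum>k\<in>S. mv k) - 3 \<le> (\<Sum>k\<in>A. mv k)"
      by simp
    also have "\<dots> \<le> (\<Sum>k\<in>A. 2 * (y (k - 1) - c)\<^sup>2 + 2 * (y k - c)\<^sup>2)"
    proof (rule sum_mono)
      fix k
      have "mv k \<le> (y k - y (k - 1))\<^sup>2"
      proof (cases "z k = z (k - 1)")
        case False
        then have "1 \<le> \<bar>y k - y (k - 1)\<bar>"
          unfolding y_def by linarith
        then show ?thesis
          using abs_le_square_iff[of 1 "y k - y (k - 1)"] by (simp add: mv_def)
      qed (simp add: mv_def)
      also have "\<dots> \<le> 2 * (y (k - 1) - c)\<^sup>2 + 2 * (y k - c)\<^sup>2"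
        using zero_le_power2[of "(y (k - 1) - c) + (y k - c)"] by (simp add: power2_eq_square algebra_simps)
      finally show "mv k \<le> 2 * (y (k - 1) - c)\<^sup>2 + 2 * (y k - c)\<^sup>2" .
    qed
    \<comment> \<open>Shifting the index by one turns \<open>y k\<close> into the lagged value
      belonging to \<open>k + 1\<close>.\<close>
    also have "\<dots> = 2 * (\<Sum>k\<in>A. (y (k - 1) - c)\<^sup>2) + 2 * (\<Sum>k\<in>Suc ` A. (y (k - 1) - c)\<^sup>2)"
      by (simp add: sum.distrib sum_distrib_left sum.reindex)
    also have "\<dots> \<le> 2 * (\<Sum>k\<in>S. (y (k - 1) - c)\<^sup>2) + 2 * (\<Sum>k\<in>S. (y (k - 1) - c)\<^sup>2)"
      using A by (intro add_mono mult_left_mono sum_mono2) auto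
    finally show ?thesis
      by simp
  qed
  then have "(real n - 2) * ((\<Sum>k\<in>S. mv k) - 3) \<le> (real n - 2) * (4 * (\<Sum>k\<in>S. (y (k - 1) - c)\<^sup>2))"
    using assms by (intro mult_left_mono) auto
  ultimately show ?thesis
    unfolding sumstar_def S_def[symmetric] y_def[symmetric] mv_def[symmetric] by simp
qed

end

section \<open>Consistency along a single path\<close>

text \<open>Deterministic: two averages tending to 0 and a positive lower frequency of moves are all
  that is asked of the path.\<close>

lemma estimators_converge:
  fixes z :: "nat \<Rightarrow> nat" and \<alpha> \<mu> \<delta> :: real and s1 s2 :: nat
  defines "y \<equiv> \<lambda>k. real (z k)"
  assumes s: "1 \<le> s1" "1 \<le> s2" "s1 \<noteq> s2" and "\<alpha> < 1"
    and resid: "(\<lambda>n. sumstar n s1 s2 (\<lambda>k. y k - \<alpha> * y (k - 1) - \<mu>) / real n) \<longlonglongrightarrow> 0"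
    and cross: "(\<lambda>n. sumstar n s1 s2 (\<lambda>k. y (k - 1) * (y k - \<alpha> * y (k - 1) - \<mu>)) / real n) \<longlonglongrightarrow> 0"
    and "0 < \<delta>"
    and moves: "eventually (\<lambda>n. \<delta> * real n \<le> sumstar n s1 s2 (\<lambda>k. if z k \<noteq> z (k - 1) then 1 else 0)) sequentially"
  shows "eventually (\<lambda>n. 0 < Dn n s1 s2 y) sequentially"
    and "(\<lambda>n. alpha_hat n s1 s2 y) \<longlonglongrightarrow> \<alpha>"
    and "(\<lambda>n. mu_hat n s1 s2 y) \<longlonglongrightarrow> \<mu>"
    and "(\<lambda>n. theta_hat n s1 s2 y t) \<longlonglongrightarrow> y t - \<alpha> * y (t - 1) - \<mu>"
proof -
  define A where "A n = sumstar n s1 s2 (\<lambda>k. y k - \<alpha> * y (k - 1) - \<mu>)" for n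
  define B where "B n = sumstar n s1 s2 (\<lambda>k. y (k - 1) * (y k - \<alpha> * y (k - 1) - \<mu>))" for n
  define T where "T n = sumstar n s1 s2 (\<lambda>k. y (k - 1))" for n
  \<comment> \<open>\<open>K\<close> comes from
    \<open>A n = (y n - C0) + (1 - \<alpha>) * T n - (n - 2) * \<mu>\<close>, where
    \<open>C0\<close> collects the fixed boundary terms of the telescoping sum. With
    \<open>0 \<le> y n\<close>, \<open>C0 \<le> n\<close> and \<open>A n \<le> n\<close> this gives
    \<open>(1 - \<alpha>) * T n \<le> (2 + \<bar>\<mu>\<bar>) * n\<close>.\<close>
  define K where "K = (\<bar>\<mu>\<bar> + 2) / (1 - \<alpha>)"
  define C0 where "C0 = y 0 + (y s1 - y (s1 - 1)) + (y s2 - y (s2 - 1))"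
  have A0: "(\<lambda>n. A n / real n) \<longlonglongrightarrow> 0" and B0: "(\<lambda>n. B n / real n) \<longlonglongrightarrow> 0"
    using resid cross by (simp_all add: A_def B_def)
  have large: "eventually (\<lambda>n. s1 \<le> n \<and> s2 \<le> n \<and> c \<le> real n) sequentially" for c
    using eventually_ge_at_top[of s1] eventually_ge_at_top[of s2] eventually_ge_at_top[of "nat \<lceil>c\<rceil>"]
    by eventually_elim (auto simp: nat_le_iff ceiling_le_iff)
  have T_nonneg: "0 \<le> T n" for n
    by (simp add: T_def y_def sumstar_nonneg)
  have "eventually (\<lambda>n. A n / real n < 1) sequentially"
    using order_tendstoD(2)[OF A0, of 1] by simp
  then have T_le: "eventually (\<lambda>n. T n \<le> K * n) sequentially"
    using large[of "max 3 C0"]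
  proof eventually_elim
    case (elim n)
    then have n: "s1 \<le> n" "s2 \<le> n" and "3 \<le> n" and "C0 \<le> n" and "A n \<le> n"
      by (auto simp: field_simps)
    have "A n = sumstar n s1 s2 y - \<alpha> * T n - (real n - 2) * \<mu>"
      by (simp add: A_def T_def sumstar_diff sumstar_mult sumstar_const[OF s n])
    also have "sumstar n s1 s2 y = T n + (y n - C0)"
      using sumstar_telescope[OF s n, of y] by (simp add: sumstar_diff T_def C0_def)
    finally have "A n = (y n - C0) + (1 - \<alpha>) * T n - (real n - 2) * \<mu>"
      by (simp add: algebra_simps)
    then have "(1 - \<alpha>) * T n \<le> real n * (1 + 1) + (real n - 2) * \<mu>"
      using \<open>C0 \<le> n\<close> \<open>A n \<le> n\<close> by (simp add: y_def)
    also have "(real n - 2) * \<mu> \<le> (real n - 2) * \<bar>\<mu>\<bar>"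
      using \<open>3 \<le> n\<close> by (intro mult_left_mono) auto
    also have "\<dots> \<le> real n * \<bar>\<mu>\<bar>"
      by (intro mult_right_mono) auto
    finally show ?case
      using \<open>\<alpha> < 1\<close> by (simp add: K_def field_simps)
  qed
  \<comment> \<open>The factor 16: \<open>n - 2 \<ge> n / 2\<close> once \<open>n \<ge> 4\<close>,
    the number of moves minus 3 is at least \<open>\<delta> * n / 2\<close> once
    \<open>\<delta> * n \<ge> 6\<close>, and \<open>Dn_lower_bound\<close> divides by 4.\<close>
  have D_ge: "eventually (\<lambda>n. \<delta> / 16 * (real n)\<^sup>2 \<le> Dn n s1 s2 y) sequentially"
    using moves large[of "max 4 (6 / \<delta>)"]
  proof eventually_elim
    case (elim n)
    then have n: "s1 \<le> n" "s2 \<le> n" and "4 \<le> n" and "6 \<le> \<delta> * n"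
      using \<open>0 < \<delta>\<close> by (auto simp: field_simps)
    have "\<delta> / 16 * (real n)\<^sup>2 = (real n / 2) * (\<delta> * real n / 2) / 4"
      by (simp add: power2_eq_square)
    also have "\<dots> \<le> (real n - 2) * (sumstar n s1 s2 (\<lambda>k. if z k \<noteq> z (k - 1) then 1 else 0) - 3) / 4"
      using elim \<open>4 \<le> n\<close> \<open>6 \<le> \<delta> * n\<close> \<open>0 < \<delta>\<close> by (intro divide_right_mono mult_mono) auto
    also have "\<dots> \<le> Dn n s1 s2 y"
      unfolding y_def using \<open>4 \<le> n\<close> by (intro Dn_lower_bound s n) auto
    finally show ?case .
  qed
  show D_pos: "eventually (\<lambda>n. 0 < Dn n s1 s2 y) sequentially"
    using D_ge eventually_gt_at_top[of 0]
  proof eventually_elim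
    case (elim n)
    then have "0 < \<delta> / 16 * (real n)\<^sup>2"
      using \<open>0 < \<delta>\<close> by simp
    with elim show ?case
      by linarith
  qed
  \<comment> \<open>In the error formula \<open>T n \<le> K * n\<close> makes the numerator
    \<open>o(n\<^sup>2)\<close>, while the denominator is at least of order
    \<open>n\<^sup>2\<close>.\<close>
  have "(\<lambda>n. alpha_hat n s1 s2 y - \<alpha>) \<longlonglongrightarrow> 0"
  proof (rule Lim_null_comparison)
    show "(\<lambda>n. 16 / \<delta> * (\<bar>B n / real n\<bar> + K * \<bar>A n / real n\<bar>)) \<longlonglongrightarrow> 0"
      using tendsto_mult[OF tendsto_const[of "16 / \<delta>"] tendsto_add[OF tendsto_rabs[OF B0]
        tendsto_mult[OF tendsto_const[of K] tendsto_rabs[OF A0]]]] by simp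
    show "eventually (\<lambda>n. norm (alpha_hat n s1 s2 y - \<alpha>) \<le> 16 / \<delta> * (\<bar>B n / real n\<bar> + K * \<bar>A n / real n\<bar>)) sequentially"
      using D_pos D_ge T_le large[of 3]
    proof eventually_elim
      case (elim n)
      then have n: "s1 \<le> n" "s2 \<le> n" and "3 \<le> n"
        by auto
      have "alpha_hat n s1 s2 y - \<alpha> = ((real n - 2) * B n - A n * T n) / Dn n s1 s2 y"
        unfolding A_def B_def T_def using elim by (intro alpha_hat_error s n) auto
      then have "norm (alpha_hat n s1 s2 y - \<alpha>) = \<bar>(real n - 2) * B n - A n * T n\<bar> / Dn n s1 s2 y"
        using elim by simp
      also have "\<dots> \<le> (real n * \<bar>B n\<bar> + \<bar>A n\<bar> * (K * n)) / (\<delta> / 16 * (real n)\<^sup>2)"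
      proof (rule frac_le)
        have "\<bar>(real n - 2) * B n\<bar> \<le> real n * \<bar>B n\<bar>" "\<bar>A n * T n\<bar> \<le> \<bar>A n\<bar> * (K * n)"
          using elim \<open>3 \<le> n\<close> T_nonneg[of n] by (auto simp: abs_mult intro!: mult_mono)
        then show "\<bar>(real n - 2) * B n - A n * T n\<bar> \<le> real n * \<bar>B n\<bar> + \<bar>A n\<bar> * (K * n)"
          by linarith
        show "0 \<le> real n * \<bar>B n\<bar> + \<bar>A n\<bar> * (K * n)"
          using \<open>\<alpha> < 1\<close> by (simp add: K_def)
      qed (use elim \<open>3 \<le> n\<close> \<open>0 < \<delta>\<close> in auto)
      also have "\<dots> = 16 / \<delta> * (\<bar>B n / real n\<bar> + K * \<bar>A n / real n\<bar>)"
        using \<open>3 \<le> n\<close> \<open>0 < \<delta>\<close> by (simp add: field_simps power2_eq_square)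
      finally show ?case .
    qed
  qed
  then show alpha: "(\<lambda>n. alpha_hat n s1 s2 y) \<longlonglongrightarrow> \<alpha>"
    by (rule LIM_zero_cancel)
  \<comment> \<open>The intercept formula reduces this error to the residual mean and the error of
    \<open>alpha_hat\<close> times a bounded lagged mean.\<close>
  have "(\<lambda>n. mu_hat n s1 s2 y - \<mu>) \<longlonglongrightarrow> 0"
  proof (rule Lim_null_comparison)
    show "(\<lambda>n. 3 * \<bar>A n / real n\<bar> + \<bar>alpha_hat n s1 s2 y - \<alpha>\<bar> * (3 * K)) \<longlonglongrightarrow> 0"
      using tendsto_add[OF tendsto_mult[OF tendsto_const[of 3] tendsto_rabs[OF A0]]
        tendsto_mult[OF tendsto_rabs[OF LIM_zero[OF alpha]] tendsto_const[of "3 * K"]]] by simp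
    show "eventually (\<lambda>n. norm (mu_hat n s1 s2 y - \<mu>) \<le> 3 * \<bar>A n / real n\<bar> + \<bar>alpha_hat n s1 s2 y - \<alpha>\<bar> * (3 * K)) sequentially"
      using D_pos T_le large[of 3]
    proof eventually_elim
      case (elim n)
      then have n: "s1 \<le> n" "s2 \<le> n" and "3 \<le> n"
        by auto
      have A: "A n = sumstar n s1 s2 y - \<alpha> * T n - (real n - 2) * \<mu>"
        by (simp add: A_def T_def sumstar_diff sumstar_mult sumstar_const[OF s n])
      have eq: "mu_hat n s1 s2 y = (sumstar n s1 s2 y - alpha_hat n s1 s2 y * T n) / (real n - 2)"
        unfolding T_def using elim \<open>3 \<le> n\<close> by (intro mu_hat_eq s n) auto
      have "mu_hat n s1 s2 y - \<mu> = A n / (real n - 2) - (alpha_hat n s1 s2 y - \<alpha>) * (T n / (real n - 2))"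
      proof -
        define N where "N = real n - 2"
        have "N \<noteq> 0"
          using \<open>3 \<le> n\<close> by (simp add: N_def)
        then show ?thesis
          unfolding eq A N_def[symmetric] by (simp add: diff_divide_distrib left_diff_distrib)
      qed
      also have "norm \<dots> \<le> \<bar>A n / (real n - 2)\<bar> + \<bar>alpha_hat n s1 s2 y - \<alpha>\<bar> * \<bar>T n / (real n - 2)\<bar>"
        unfolding abs_mult[symmetric] real_norm_def by (rule abs_triangle_ineq4)
      also have "\<dots> \<le> 3 * \<bar>A n / real n\<bar> + \<bar>alpha_hat n s1 s2 y - \<alpha>\<bar> * (3 * K)"
      proof (intro add_mono mult_left_mono)
        \<comment> \<open>For \<open>n \<ge> 3\<close> one has \<open>n \<le> 3 * (n - 2)\<close>,
          the source of every 3 in the comparison sequence.\<close>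
        have inv: "1 / (real n - 2) \<le> 3 / n"
          using \<open>3 \<le> n\<close> by (simp add: field_simps)
        have "\<bar>A n / (real n - 2)\<bar> = \<bar>A n\<bar> * (1 / (real n - 2))"
          using \<open>3 \<le> n\<close> by simp
        also have "\<dots> \<le> \<bar>A n\<bar> * (3 / n)"
          by (rule mult_left_mono[OF inv]) simp
        also have "\<dots> = 3 * \<bar>A n / real n\<bar>"
          by (simp add: abs_divide)
        finally show "\<bar>A n / (real n - 2)\<bar> \<le> 3 * \<bar>A n / real n\<bar>" .
        have "T n / (real n - 2) \<le> T n * (3 / n)"
          using mult_left_mono[OF inv T_nonneg[of n]] by simp
        also have "\<dots> \<le> K * n * (3 / n)"
          using elim by (intro mult_right_mono) auto
        finally show "\<bar>T n / (real n - 2)\<bar> \<le> 3 * K"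
          using T_nonneg[of n] \<open>3 \<le> n\<close> by simp
      qed simp
      finally show ?case .
    qed
  qed
  then show mu: "(\<lambda>n. mu_hat n s1 s2 y) \<longlonglongrightarrow> \<mu>"
    by (rule LIM_zero_cancel)
  show "(\<lambda>n. theta_hat n s1 s2 y t) \<longlonglongrightarrow> y t - \<alpha> * y (t - 1) - \<mu>"
    unfolding theta_hat_def by (intro tendsto_intros alpha mu)
qed

section \<open>The driving variables and the moments of the process\<close>

text \<open>The generators have exactly the form of the preimage families in
  \<open>indep_vars_def2\<close>, so that independence of the family \<open>X\<close> can be grouped
  into blocks directly.\<close>

definition gen_sigma :: "'w measure \<Rightarrow> ('i \<Rightarrow> 'w \<Rightarrow> nat) \<Rightarrow> 'i set \<Rightarrow> 'w measure" where
  "gen_sigma M X A = sigma (space M) (\<Union>i\<in>A. {X i -` B \<inter> space M | B. B \<in> sets (count_space UNIV)})"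

lemma space_gen_sigma [simp]: "space (gen_sigma M X A) = space M"
  unfolding gen_sigma_def by (intro space_measure_of) auto

lemma sets_gen_sigma:
  "sets (gen_sigma M X A) = sigma_sets (space M) (\<Union>i\<in>A. {X i -` B \<inter> space M | B. B \<in> sets (count_space UNIV)})"
  unfolding gen_sigma_def by (intro sets_measure_of) auto

lemma sets_gen_sigma_mono: "A \<subseteq> B \<Longrightarrow> sets (gen_sigma M X A) \<subseteq> sets (gen_sigma M X B)"
  unfolding sets_gen_sigma by (intro sigma_sets_mono') blast

lemma gen_sigma_mono: "f \<in> measurable (gen_sigma M X A) N \<Longrightarrow> A \<subseteq> B \<Longrightarrow> f \<in> measurable (gen_sigma M X B) N"
  using sets_gen_sigma_mono[of A B M X] by (auto simp: measurable_def)

lemma measurable_gen_sigma: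
  assumes "i \<in> A"
  shows "X i \<in> measurable (gen_sigma M X A) (count_space UNIV)"
proof (rule measurableI)
  fix B assume "B \<in> sets (count_space (UNIV :: nat set))"
  then show "X i -` B \<inter> space (gen_sigma M X A) \<in> sets (gen_sigma M X A)"
    unfolding sets_gen_sigma space_gen_sigma using assms by (intro sigma_sets.Basic) auto
qed simp

lemma measurable_real_gen_sigma:
  "i \<in> A \<Longrightarrow> (\<lambda>\<omega>. real (X i \<omega>)) \<in> borel_measurable (gen_sigma M X A)"
  by (rule measurable_compose[OF measurable_gen_sigma]) auto

lemma subalgebra_gen_sigma:
  assumes "\<And>i. i \<in> A \<Longrightarrow> X i \<in> measurable M (count_space UNIV)"
  shows "subalgebra M (gen_sigma M X A)"
proof -
  have "sets (gen_sigma M X A) \<subseteq> sets M"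
    unfolding sets_gen_sigma by (intro sets.sigma_sets_subset) (use assms in \<open>auto intro: measurable_sets\<close>)
  then show ?thesis
    by (simp add: subalgebra_def)
qed

section \<open>Independence of disjoint blocks of variables\<close>

text \<open>The preimage families are closed under intersection, so their independence passes to the
  sigma-algebras generated by disjoint groups of them.\<close>

lemma (in prob_space) indep_set_gen_sigma:
  assumes ind: "indep_vars (\<lambda>_. count_space UNIV) X I" and "A \<subseteq> I" "B \<subseteq> I" "A \<inter> B = {}"
  shows "indep_set (sets (gen_sigma M X A)) (sets (gen_sigma M X B))"
proof -
  let ?E = "\<lambda>i. {X i -` C \<inter> space M | C. C \<in> sets (count_space UNIV)}"
  have "indep_sets ?E I"
    using ind by (simp add: indep_vars_def2)
  then have "indep_sets ?E (\<Union>j\<in>UNIV. case_bool A B j)"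
    by (rule indep_sets_mono_index[rotated]) (use assms in \<open>auto split: bool.splits\<close>)
  then have "indep_sets (\<lambda>j. sigma_sets (space M) (\<Union>i\<in>case_bool A B j. ?E i)) UNIV"
  proof (rule indep_sets_collect_sigma)
    show "Int_stable (?E i)" for i
    proof (rule Int_stableI)
      fix a b assume "a \<in> ?E i" "b \<in> ?E i"
      then obtain C C' where "a = X i -` C \<inter> space M" "b = X i -` C' \<inter> space M"
        by auto
      then have "a \<inter> b = X i -` (C \<inter> C') \<inter> space M"
        by auto
      then show "a \<inter> b \<in> ?E i"
        by (intro CollectI exI[of _ "C \<inter> C'"]) simp
    qed
    show "disjoint_family_on (case_bool A B) UNIV"
      using assms(4) by (auto simp: disjoint_family_on_def split: bool.splits)
  qed
  moreover have "(\<lambda>j. sigma_sets (space M) (\<Union>i\<in>case_bool A B j. ?E i))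
      = case_bool (sets (gen_sigma M X A)) (sets (gen_sigma M X B))"
    by (rule ext) (simp add: sets_gen_sigma split: bool.split)
  ultimately show ?thesis
    by (simp add: indep_set_def)
qed

text \<open>The sigma-algebras generated by \<open>f\<close> and \<open>g\<close> sit inside those
  of two disjoint blocks and inherit their independence.\<close>

lemma (in prob_space) indep_var_gen_sigma:
  assumes ind: "indep_vars (\<lambda>_. count_space UNIV) X I" and AB: "A \<subseteq> I" "B \<subseteq> I" "A \<inter> B = {}"
    and f: "f \<in> measurable (gen_sigma M X A) S" and g: "g \<in> measurable (gen_sigma M X B) T"
  shows "indep_var S f T g"
proof -
  have rv: "X i \<in> measurable M (count_space UNIV)" if "i \<in> I" for i
    using ind that by (simp add: indep_vars_def2)
  have sub: "sigma_sets (space M) {h -` C \<inter> space M | C. C \<in> sets U} \<subseteq> sets (gen_sigma M X J)"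
    if "h \<in> measurable (gen_sigma M X J) U" for h U J
    using sets.sigma_sets_subset[of "{h -` C \<inter> space M | C. C \<in> sets U}" "gen_sigma M X J"]
      measurable_sets[OF that] by auto
  have "f \<in> measurable M S" "g \<in> measurable M T"
    using AB by (auto intro!: measurable_from_subalg[OF subalgebra_gen_sigma f]
      measurable_from_subalg[OF subalgebra_gen_sigma g] rv)
  moreover have "indep_set (sigma_sets (space M) {f -` C \<inter> space M | C. C \<in> sets S})
      (sigma_sets (space M) {g -` C \<inter> space M | C. C \<in> sets T})"
    using indep_set_gen_sigma[OF ind AB] sub[OF f] sub[OF g]
    unfolding indep_sets2_eq by blast
  ultimately show ?thesis
    by (simp add: indep_var_eq)
qed

text \<open>The product rule in extended nonnegative reals, usable before any integrability is
  known.\<close>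

lemma (in prob_space) indep_var_nn_integral:
  fixes f g :: "'a \<Rightarrow> ennreal"
  assumes "indep_var borel f borel g"
  shows "(\<integral>\<^sup>+\<omega>. f \<omega> * g \<omega> \<partial>M) = (\<integral>\<^sup>+\<omega>. f \<omega> \<partial>M) * (\<integral>\<^sup>+\<omega>. g \<omega> \<partial>M)"
proof -
  have "indep_vars (\<lambda>_. borel) (case_bool f g) UNIV"
  proof -
    have "case_bool borel borel = (\<lambda>_::bool. borel :: ennreal measure)"
      by (rule ext) (simp split: bool.split)
    then show ?thesis
      using assms by (simp add: indep_var_def)
  qed
  from indep_vars_nn_integral[OF _ this] show ?thesis
    by (simp add: UNIV_bool mult.commute)
qed

section \<open>The model and its Markov structure\<close>

locale inar = prob_space M
  for M :: "'w measure" +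
  fixes X :: "inar_idx \<Rightarrow> 'w \<Rightarrow> nat" and \<alpha> :: real and s1 s2 \<theta>1 \<theta>2 :: nat
  assumes alpha: "0 < \<alpha>" "\<alpha> < 1"
    and s: "1 \<le> s1" "1 \<le> s2" "s1 \<noteq> s2"
    and indep: "indep_vars (\<lambda>_. count_space UNIV) X
           ({IY0} \<union> {IEps k | k. 1 \<le> k} \<union> {IXi k j | k j. 1 \<le> k \<and> 1 \<le> j})"
    and bern01: "\<And>k j \<omega>. 1 \<le> k \<Longrightarrow> 1 \<le> j \<Longrightarrow> \<omega> \<in> space M \<Longrightarrow> X (IXi k j) \<omega> \<le> 1"
    and bern: "\<And>k j. 1 \<le> k \<Longrightarrow> 1 \<le> j \<Longrightarrow> prob {\<omega> \<in> space M. X (IXi k j) \<omega> = 1} = \<alpha>"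
    and eps_id: "\<And>k. 1 \<le> k \<Longrightarrow>
           distr M (count_space UNIV) (X (IEps k)) = distr M (count_space UNIV) (X (IEps 1))"
    and eps_L2: "integrable M (\<lambda>\<omega>. (real (X (IEps 1) \<omega>))\<^sup>2)"
    and eps_nz: "prob {\<omega> \<in> space M. X (IEps 1) \<omega> \<noteq> 0} > 0"
    and Y0_L2: "integrable M (\<lambda>\<omega>. (real (X IY0 \<omega>))\<^sup>2)"
begin

definition idx :: "inar_idx set" where
  "idx = {IY0} \<union> {IEps k | k. 1 \<le> k} \<union> {IXi k j | k j. 1 \<le> k \<and> 1 \<le> j}"

text \<open>\<open>past k\<close> indexes the variables that can enter \<open>Z 0\<close> to
  \<open>Z k\<close>, and \<open>fut k\<close> those that can drive the transition from
  \<open>k\<close> to \<open>k + 1\<close>. All \<open>j \<ge> 1\<close> are included because the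
  number of Bernoulli summands is random. Disjointness of the two sets is the source of the Markov
  property.\<close>

definition past :: "nat \<Rightarrow> inar_idx set" where
  "past k = {IY0} \<union> {IEps i | i. 1 \<le> i \<and> i \<le> k} \<union> {IXi i j | i j. 1 \<le> i \<and> i \<le> k \<and> 1 \<le> j}"

definition fut :: "nat \<Rightarrow> inar_idx set" where
  "fut k = {IEps (Suc k)} \<union> {IXi (Suc k) j | j. 1 \<le> j}"

definition \<mu> :: real where "\<mu> = expectation (\<lambda>\<omega>. real (X (IEps 1) \<omega>))"

definition out :: "nat \<Rightarrow> nat" where
  "out k = (if Suc k = s1 then \<theta>1 else 0) + (if Suc k = s2 then \<theta>2 else 0)"

text \<open>The transition from \<open>k\<close> to \<open>k + 1\<close> with the present value
  frozen at a fixed \<open>y\<close>. Thus \<open>step k y\<close> depends on \<open>fut k\<close>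
  alone and is independent of the past.\<close>

definition step :: "nat \<Rightarrow> nat \<Rightarrow> 'w \<Rightarrow> nat" where
  "step k y \<omega> = (\<Sum>j=1..y. X (IXi (Suc k) j) \<omega>) + X (IEps (Suc k)) \<omega> + out k"

definition Z :: "nat \<Rightarrow> 'w \<Rightarrow> nat" where
  "Z k \<omega> = inarY (\<lambda>k j. X (IXi k j) \<omega>) (\<lambda>k. X (IEps k) \<omega>) (X IY0 \<omega>) s1 s2 \<theta>1 \<theta>2 k"

lemma Z_0: "Z 0 \<omega> = X IY0 \<omega>"
  and Z_Suc: "Z (Suc k) \<omega> = step k (Z k \<omega>) \<omega>"
  by (simp_all add: Z_def step_def out_def)

lemma indep_idx: "indep_vars (\<lambda>_. count_space UNIV) X idx"
  using indep by (simp add: idx_def)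

lemma past_sub: "past k \<subseteq> idx" and fut_sub: "fut k \<subseteq> idx" and past_fut: "past k \<inter> fut k = {}"
  and past_Suc: "past (Suc k) = past k \<union> fut k"
  by (auto simp: past_def fut_def idx_def)

lemma X_meas: "i \<in> idx \<Longrightarrow> X i \<in> measurable M (count_space UNIV)"
  using indep_idx by (simp add: indep_vars_def2)

lemma real_X_meas: "i \<in> idx \<Longrightarrow> (\<lambda>\<omega>. real (X i \<omega>)) \<in> borel_measurable M"
  by (rule measurable_compose[OF X_meas]) auto

lemma subalg: "A \<subseteq> idx \<Longrightarrow> subalgebra M (gen_sigma M X A)"
  by (intro subalgebra_gen_sigma X_meas) auto

lemma step_fut: "step k y \<in> measurable (gen_sigma M X (fut k)) (count_space UNIV)"
proof -
  have [measurable]: "X (IEps (Suc k)) \<in> measurable (gen_sigma M X (fut k)) (count_space UNIV)"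
    by (rule measurable_gen_sigma) (simp add: fut_def)
  show ?thesis
    unfolding step_def[abs_def]
    by measurable (auto intro!: measurable_gen_sigma simp: fut_def)
qed

lemma Z_past: "Z k \<in> measurable (gen_sigma M X (past k)) (count_space UNIV)"
proof (induction k)
  case 0
  show ?case
    unfolding Z_0[abs_def] by (rule measurable_gen_sigma) (simp add: past_def)
next
  case (Suc k)
  have "Z k \<in> measurable (gen_sigma M X (past (Suc k))) (count_space UNIV)"
    by (rule gen_sigma_mono[OF Suc]) (simp add: past_Suc)
  \<comment> \<open>The present value is random but takes countably many values, so it is enough to
    have measurability for each frozen \<open>y\<close>.\<close>
  moreover have "step k y \<in> measurable (gen_sigma M X (past (Suc k))) (count_space UNIV)" for y
    by (rule gen_sigma_mono[OF step_fut]) (simp add: past_Suc)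
  ultimately show ?case
    unfolding Z_Suc[abs_def] by (rule measurable_compose_countable[rotated])
qed

lemma Z_meas [measurable]: "Z k \<in> measurable M (count_space UNIV)"
  using measurable_from_subalg[OF subalg[OF past_sub] Z_past] .

lemma step_meas [measurable]: "step k y \<in> measurable M (count_space UNIV)"
  using measurable_from_subalg[OF subalg[OF fut_sub] step_fut] .

lemma eps_idx: "IEps (Suc k) \<in> idx" and xi_idx: "1 \<le> j \<Longrightarrow> IXi (Suc k) j \<in> idx"
  by (auto simp: idx_def)

lemma eps_transfer:
  fixes f :: "nat \<Rightarrow> real"
  shows "integrable M (\<lambda>\<omega>. f (X (IEps (Suc k)) \<omega>)) \<longleftrightarrow> integrable M (\<lambda>\<omega>. f (X (IEps 1) \<omega>))"
    and "expectation (\<lambda>\<omega>. f (X (IEps (Suc k)) \<omega>)) = expectation (\<lambda>\<omega>. f (X (IEps 1) \<omega>))"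
proof -
  have m: "X (IEps (Suc j)) \<in> measurable M (count_space UNIV)" for j
    by (rule X_meas[OF eps_idx])
  show "integrable M (\<lambda>\<omega>. f (X (IEps (Suc k)) \<omega>)) \<longleftrightarrow> integrable M (\<lambda>\<omega>. f (X (IEps 1) \<omega>))"
    using integrable_distr_eq[OF m[of k], of f] integrable_distr_eq[OF m[of 0], of f] eps_id[of "Suc k"] by simp
  show "expectation (\<lambda>\<omega>. f (X (IEps (Suc k)) \<omega>)) = expectation (\<lambda>\<omega>. f (X (IEps 1) \<omega>))"
    using integral_distr[OF m[of k], of f] integral_distr[OF m[of 0], of f] eps_id[of "Suc k"] by simp
qed

section \<open>Moments of one transition from a frozen value\<close>

definition V :: real where "V = expectation (\<lambda>\<omega>. (real (X (IEps 1) \<omega>) - \<mu>)\<^sup>2)"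

lemma eps_moments:
  shows "integrable M (\<lambda>\<omega>. real (X (IEps (Suc k)) \<omega>))"
    and "expectation (\<lambda>\<omega>. real (X (IEps (Suc k)) \<omega>)) = \<mu>"
    and "integrable M (\<lambda>\<omega>. (real (X (IEps (Suc k)) \<omega>) - \<mu>)\<^sup>2)"
    and "expectation (\<lambda>\<omega>. (real (X (IEps (Suc k)) \<omega>) - \<mu>)\<^sup>2) = V"
proof -
  have 1: "integrable M (\<lambda>\<omega>. real (X (IEps 1) \<omega>))"
    using square_integrable_imp_integrable[OF _ eps_L2] real_X_meas[OF eps_idx[of 0]] by simp
  then show "integrable M (\<lambda>\<omega>. real (X (IEps (Suc k)) \<omega>))"
    using eps_transfer(1)[of real k] by simp
  show "expectation (\<lambda>\<omega>. real (X (IEps (Suc k)) \<omega>)) = \<mu>"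
    using eps_transfer(2)[of real k] by (simp add: \<mu>_def)
  have "integrable M (\<lambda>\<omega>. (real (X (IEps 1) \<omega>) - \<mu>)\<^sup>2)"
    unfolding power2_diff using 1 eps_L2 by (intro Bochner_Integration.integrable_add Bochner_Integration.integrable_diff) auto
  then show "integrable M (\<lambda>\<omega>. (real (X (IEps (Suc k)) \<omega>) - \<mu>)\<^sup>2)"
    using eps_transfer(1)[of "\<lambda>x. (real x - \<mu>)\<^sup>2" k] by simp
  show "expectation (\<lambda>\<omega>. (real (X (IEps (Suc k)) \<omega>) - \<mu>)\<^sup>2) = V"
    using eps_transfer(2)[of "\<lambda>x. (real x - \<mu>)\<^sup>2" k] by (simp add: V_def)
qed

lemma V_nonneg: "0 \<le> V" and mu_nonneg: "0 \<le> \<mu>"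
  by (simp_all add: V_def \<mu>_def)

lemma xi_moments:
  fixes j k :: nat
  assumes "1 \<le> j"
  defines "c \<equiv> \<lambda>\<omega>. real (X (IXi (Suc k) j) \<omega>) - \<alpha>"
  shows "c \<in> borel_measurable M"
    and "integrable M c" and "expectation c = 0" and "integrable M (\<lambda>\<omega>. (c \<omega>)\<^sup>2)" and "expectation (\<lambda>\<omega>. (c \<omega>)\<^sup>2) \<le> 1"
proof -
  note [measurable] = real_X_meas[OF xi_idx[OF assms(1), of k]]
  note m = X_meas[OF xi_idx[OF assms(1), of k], measurable]
  show [measurable]: "c \<in> borel_measurable M"
    unfolding c_def by measurable
  have le: "X (IXi (Suc k) j) \<omega> \<le> 1" if "\<omega> \<in> space M" for \<omega>
    using bern01[of "Suc k" j] assms that by simp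
  have b: "\<bar>c \<omega>\<bar> \<le> 1" if "\<omega> \<in> space M" for \<omega>
    using le[OF that] alpha unfolding c_def by linarith
  have b2: "(c \<omega>)\<^sup>2 \<le> 1" if "\<omega> \<in> space M" for \<omega>
    using b[OF that] by (simp add: abs_square_le_1)
  show "integrable M c"
    by (rule integrable_const_bound[of _ 1]) (auto intro!: AE_I2 b)
  show i2: "integrable M (\<lambda>\<omega>. (c \<omega>)\<^sup>2)"
    by (rule integrable_const_bound[of _ 1]) (auto intro!: AE_I2 b2)
  show "expectation (\<lambda>\<omega>. (c \<omega>)\<^sup>2) \<le> 1"
    using integral_mono[OF i2 integrable_const[of 1]] b2 by (simp add: prob_space)
  have "expectation (\<lambda>\<omega>. real (X (IXi (Suc k) j) \<omega>))
      = expectation (indicator {\<omega> \<in> space M. X (IXi (Suc k) j) \<omega> = 1})"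
    by (intro Bochner_Integration.integral_cong refl) (use le in \<open>force simp: indicator_def le_Suc_eq\<close>)
  also have "\<dots> = \<alpha>"
    using bern[of "Suc k" j] assms(1) by simp
  finally have "expectation (\<lambda>\<omega>. real (X (IXi (Suc k) j) \<omega>)) = \<alpha>" .
  moreover have "integrable M (\<lambda>\<omega>. real (X (IXi (Suc k) j) \<omega>))"
    by (rule integrable_const_bound[of _ 1]) (auto intro!: AE_I2 dest: le)
  ultimately show "expectation c = 0"
    unfolding c_def by (simp add: prob_space)
qed

text \<open>The centred randomness of a transition from \<open>y\<close>; away from the outlier
  times it is the residual \<open>step k y \<omega> - \<alpha> * y - \<mu>\<close>.\<close>

definition noise :: "nat \<Rightarrow> nat \<Rightarrow> 'w \<Rightarrow> real" where
  "noise k y \<omega> = (\<Sum>j=1..y. real (X (IXi (Suc k) j) \<omega>) - \<alpha>) + (real (X (IEps (Suc k)) \<omega>) - \<mu>)"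

lemma step_eq_noise: "real (step k y \<omega>) = \<alpha> * real y + \<mu> + real (out k) + noise k y \<omega>"
  by (simp add: step_def noise_def sum_subtractf)

text \<open>The last Bernoulli variable is independent of the preceding ones and centred, so its
  cross term vanishes and second moments add. Each is bounded crudely by 1, as only linear growth in
  \<open>y\<close> matters.\<close>

lemma thinning_moments:
  defines "W \<equiv> \<lambda>k y \<omega>. \<Sum>j=1..y. real (X (IXi (Suc k) j) \<omega>) - \<alpha>"
  shows "W k y \<in> borel_measurable M" "integrable M (W k y)" "expectation (W k y) = 0"
    "integrable M (\<lambda>\<omega>. (W k y \<omega>)\<^sup>2)" "expectation (\<lambda>\<omega>. (W k y \<omega>)\<^sup>2) \<le> real y"
proof -
  have "W k y \<in> borel_measurable M \<and> integrable M (W k y) \<and> expectation (W k y) = 0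
    \<and> integrable M (\<lambda>\<omega>. (W k y \<omega>)\<^sup>2) \<and> expectation (\<lambda>\<omega>. (W k y \<omega>)\<^sup>2) \<le> real y"
  proof (induction y)
    case 0
    then show ?case
      by (simp add: W_def)
  next
    case (Suc y)
    define c where "c \<omega> = real (X (IXi (Suc k) (Suc y)) \<omega>) - \<alpha>" for \<omega>
    have c: "c \<in> borel_measurable M" "integrable M c" "expectation c = 0"
      "integrable M (\<lambda>\<omega>. (c \<omega>)\<^sup>2)" "expectation (\<lambda>\<omega>. (c \<omega>)\<^sup>2) \<le> 1"
      using xi_moments[of "Suc y" k] by (simp_all add: c_def[abs_def])
    have W_Suc: "W k (Suc y) \<omega> = W k y \<omega> + c \<omega>" for \<omega>
      by (simp add: W_def c_def)
    let ?A = "{IXi (Suc k) j | j. 1 \<le> j \<and> j \<le> y}" and ?B = "{IXi (Suc k) (Suc y)}"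
    have "W k y \<in> borel_measurable (gen_sigma M X ?A)"
      unfolding W_def by (intro borel_measurable_sum borel_measurable_diff measurable_real_gen_sigma) auto
    moreover have "c \<in> borel_measurable (gen_sigma M X ?B)"
      unfolding c_def[abs_def] by (intro borel_measurable_diff measurable_real_gen_sigma) auto
    ultimately have ind: "indep_var borel (W k y) borel c"
      by (intro indep_var_gen_sigma[OF indep_idx, of ?A ?B]) (auto simp: idx_def)
    have prod: "expectation (\<lambda>\<omega>. W k y \<omega> * c \<omega>) = 0" "integrable M (\<lambda>\<omega>. W k y \<omega> * c \<omega>)"
      using indep_var_lebesgue_integral[OF ind] indep_var_integrable[OF ind] Suc c by auto
    have sq: "(\<lambda>\<omega>. (W k y \<omega> + c \<omega>)\<^sup>2) = (\<lambda>\<omega>. ((W k y \<omega>)\<^sup>2 + (c \<omega>)\<^sup>2) + 2 * (W k y \<omega> * c \<omega>))"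
      by (simp add: power2_sum algebra_simps)
    have "integrable M (\<lambda>\<omega>. (W k y \<omega> + c \<omega>)\<^sup>2)" "expectation (\<lambda>\<omega>. (W k y \<omega> + c \<omega>)\<^sup>2) \<le> real (Suc y)"
      unfolding sq using Suc c prod by auto
    moreover have "W k (Suc y) = (\<lambda>\<omega>. W k y \<omega> + c \<omega>)"
      by (rule ext) (rule W_Suc)
    ultimately show ?case
      using Suc c by auto
  qed
  then show "W k y \<in> borel_measurable M" "integrable M (W k y)" "expectation (W k y) = 0"
    "integrable M (\<lambda>\<omega>. (W k y \<omega>)\<^sup>2)" "expectation (\<lambda>\<omega>. (W k y \<omega>)\<^sup>2) \<le> real y"
    by auto
qed

text \<open>The inequality \<open>(a + b)\<^sup>2 \<le> 2 * a\<^sup>2 + 2 * b\<^sup>2\<close>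
  separates thinning from innovation; one constant then covers both \<open>2 * y\<close> and
  \<open>2 * V\<close>.\<close>

lemma noise_moments:
  shows "noise k y \<in> borel_measurable M" "integrable M (noise k y)" "expectation (noise k y) = 0"
    "integrable M (\<lambda>\<omega>. (noise k y \<omega>)\<^sup>2)"
    "expectation (\<lambda>\<omega>. (noise k y \<omega>)\<^sup>2) \<le> (2 + 2 * V) * (1 + real y)"
proof -
  define W where "W \<omega> = (\<Sum>j=1..y. real (X (IXi (Suc k) j) \<omega>) - \<alpha>)" for \<omega>
  define e where "e \<omega> = real (X (IEps (Suc k)) \<omega>) - \<mu>" for \<omega>
  have W: "W \<in> borel_measurable M" "integrable M W" "expectation W = 0"
    "integrable M (\<lambda>\<omega>. (W \<omega>)\<^sup>2)" "expectation (\<lambda>\<omega>. (W \<omega>)\<^sup>2) \<le> real y"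
    using thinning_moments[of k y] by (simp_all add: W_def[abs_def])
  have e: "e \<in> borel_measurable M" "integrable M e" "expectation e = 0"
    "integrable M (\<lambda>\<omega>. (e \<omega>)\<^sup>2)" "expectation (\<lambda>\<omega>. (e \<omega>)\<^sup>2) = V"
    using eps_moments[of k] real_X_meas[OF eps_idx[of k]] by (simp_all add: e_def[abs_def] prob_space)
  have n: "noise k y = (\<lambda>\<omega>. W \<omega> + e \<omega>)"
    by (rule ext) (simp add: noise_def W_def e_def)
  show "noise k y \<in> borel_measurable M" "integrable M (noise k y)" "expectation (noise k y) = 0"
    unfolding n using W e by auto
  show i: "integrable M (\<lambda>\<omega>. (noise k y \<omega>)\<^sup>2)"
    unfolding n using W e by (intro integrable_square_add)
  have "expectation (\<lambda>\<omega>. (noise k y \<omega>)\<^sup>2) \<le> expectation (\<lambda>\<omega>. 2 * (W \<omega>)\<^sup>2 + 2 * (e \<omega>)\<^sup>2)"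
  proof (rule integral_mono[OF i])
    show "integrable M (\<lambda>\<omega>. 2 * (W \<omega>)\<^sup>2 + 2 * (e \<omega>)\<^sup>2)"
      using W e by auto
    show "(noise k y \<omega>)\<^sup>2 \<le> 2 * (W \<omega>)\<^sup>2 + 2 * (e \<omega>)\<^sup>2" for \<omega>
      using zero_le_power2[of "W \<omega> - e \<omega>"] by (simp add: n power2_eq_square algebra_simps)
  qed
  also have "\<dots> \<le> 2 * real y + 2 * V"
    using W e by simp
  also have "\<dots> \<le> (2 + 2 * V) * (1 + real y)"
    using V_nonneg by (simp add: algebra_simps)
  finally show "expectation (\<lambda>\<omega>. (noise k y \<omega>)\<^sup>2) \<le> (2 + 2 * V) * (1 + real y)" .
qed

section \<open>Conditioning on the present value and bounded second moments\<close>

text \<open>Conditioning done by hand: decompose over the countably many events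
  \<open>Z k = y\<close>. On each one the next value is \<open>step k y\<close>, which is
  independent of the event, so the integral factors.\<close>

lemma nn_integral_step:
  fixes g :: "nat \<Rightarrow> nat \<Rightarrow> ennreal"
  assumes "\<And>y. (\<integral>\<^sup>+\<omega>. g y (step k y \<omega>) \<partial>M) \<le> h y"
  shows "(\<integral>\<^sup>+\<omega>. g (Z k \<omega>) (Z (Suc k) \<omega>) \<partial>M) \<le> (\<integral>\<^sup>+\<omega>. h (Z k \<omega>) \<partial>M)"
proof -
  have dis: "disjoint_family (\<lambda>y. {\<omega>. Z k \<omega> = y})"
    by (auto simp: disjoint_family_on_def)
  have expand: "f (Z k \<omega>) = (\<Sum>y. f y * indicator {\<omega>. Z k \<omega> = y} \<omega>)" for f :: "nat \<Rightarrow> ennreal" and \<omega>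
    using suminf_cmult_indicator[OF dis, of \<omega> "Z k \<omega>" f] by simp
  have [measurable]: "(\<lambda>\<omega>. indicator {\<omega>. Z k \<omega> = y} \<omega> :: ennreal) \<in> borel_measurable N"
    if "Z k \<in> measurable N (count_space UNIV)" for y N
  proof -
    have "(\<lambda>\<omega>. indicator {y} (Z k \<omega>) :: ennreal) \<in> borel_measurable N"
      by (rule measurable_compose[OF that]) simp
    then show ?thesis
      by (simp add: indicator_def)
  qed
  have gm: "(\<lambda>\<omega>. g y (step k y \<omega>)) \<in> borel_measurable N"
    if "step k y \<in> measurable N (count_space UNIV)" for y N
    by (rule measurable_compose[OF that]) simp
  have indep_y: "indep_var borel (\<lambda>\<omega>. indicator {\<omega>. Z k \<omega> = y} \<omega> :: ennreal) borel (\<lambda>\<omega>. g y (step k y \<omega>))" for y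
    by (rule indep_var_gen_sigma[OF indep_idx past_sub fut_sub past_fut])
      (use Z_past gm[OF step_fut] in auto)
  have "(\<integral>\<^sup>+\<omega>. g (Z k \<omega>) (Z (Suc k) \<omega>) \<partial>M) = (\<integral>\<^sup>+\<omega>. (\<Sum>y. g y (step k y \<omega>) * indicator {\<omega>. Z k \<omega> = y} \<omega>) \<partial>M)"
    by (intro nn_integral_cong) (simp only: Z_Suc expand[of "\<lambda>y. g y (step k y _)", symmetric])
  also have "\<dots> = (\<Sum>y. \<integral>\<^sup>+\<omega>. indicator {\<omega>. Z k \<omega> = y} \<omega> * g y (step k y \<omega>) \<partial>M)"
    by (subst nn_integral_suminf) (auto simp: mult.commute intro!: borel_measurable_times_ennreal gm)
  also have "\<dots> = (\<Sum>y. (\<integral>\<^sup>+\<omega>. indicator {\<omega>. Z k \<omega> = y} \<omega> \<partial>M) * (\<integral>\<^sup>+\<omega>. g y (step k y \<omega>) \<partial>M))"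
    by (simp only: indep_var_nn_integral[OF indep_y])
  also have "\<dots> \<le> (\<Sum>y. (\<integral>\<^sup>+\<omega>. indicator {\<omega>. Z k \<omega> = y} \<omega> \<partial>M) * h y)"
    by (intro suminf_le mult_left_mono assms) auto
  also have "\<dots> = (\<Sum>y. \<integral>\<^sup>+\<omega>. h y * indicator {\<omega>. Z k \<omega> = y} \<omega> \<partial>M)"
    by (subst nn_integral_cmult) (auto simp: mult.commute)
  also have "\<dots> = (\<integral>\<^sup>+\<omega>. h (Z k \<omega>) \<partial>M)"
    by (subst nn_integral_suminf[symmetric]) (auto simp: expand[of h])
  finally show ?thesis .
qed

text \<open>A drift condition: the second moment after one step is at most a quadratic in
  \<open>y\<close> with leading coefficient \<open>\<alpha>\<^sup>2\<close>. As
  \<open>\<alpha>\<^sup>2 < \<alpha>\<close>, its excess over \<open>\<alpha> * y\<^sup>2\<close> is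
  bounded.\<close>

lemma step_second_moment:
  obtains C where "0 \<le> C" "\<And>k y. (\<integral>\<^sup>+\<omega>. ennreal ((real (step k y \<omega>))\<^sup>2) \<partial>M) \<le> ennreal (\<alpha> * (real y)\<^sup>2 + C)"
proof -
  \<comment> \<open>Both outlier sizes are put into \<open>b\<close>, so one bound serves all
    times.\<close>
  define b where "b = \<mu> + real \<theta>1 + real \<theta>2"
  define K where "K = 2 + 2 * V"
  \<comment> \<open>\<open>g\<close> is the gained quadratic coefficient and \<open>q\<close> the
    linear coefficient; \<open>q\<^sup>2 / (4 * g)\<close> is the maximum of
    \<open>q * y - g * y\<^sup>2\<close>.\<close>
  define g where "g = \<alpha> - \<alpha>\<^sup>2"
  define q where "q = 2 * \<alpha> * b + K"
  have g: "0 < g"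
    using alpha by (simp add: g_def power2_eq_square)
  have "(\<integral>\<^sup>+\<omega>. ennreal ((real (step k y \<omega>))\<^sup>2) \<partial>M) \<le> ennreal (\<alpha> * (real y)\<^sup>2 + (b\<^sup>2 + K + q\<^sup>2 / (4 * g)))" for k y
  proof -
    define c where "c = \<alpha> * real y + \<mu> + real (out k)"
    have c: "0 \<le> c" "c \<le> \<alpha> * real y + b"
      using alpha mu_nonneg by (simp_all add: c_def b_def out_def)
    have eq: "(\<lambda>\<omega>. (real (step k y \<omega>))\<^sup>2) = (\<lambda>\<omega>. (c\<^sup>2 + (noise k y \<omega>)\<^sup>2) + (2 * c) * noise k y \<omega>)"
      by (rule ext) (simp add: step_eq_noise c_def power2_sum)
    have int: "integrable M (\<lambda>\<omega>. (real (step k y \<omega>))\<^sup>2)"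
      unfolding eq using noise_moments[of k y] by auto
    have "expectation (\<lambda>\<omega>. (real (step k y \<omega>))\<^sup>2) = c\<^sup>2 + expectation (\<lambda>\<omega>. (noise k y \<omega>)\<^sup>2)"
      unfolding eq using noise_moments[of k y] by (simp add: prob_space)
    also have "\<dots> \<le> (\<alpha> * real y + b)\<^sup>2 + K * (1 + real y)"
      using c noise_moments(5)[of k y] by (intro add_mono power_mono) (auto simp: K_def)
    also have "\<dots> \<le> \<alpha> * (real y)\<^sup>2 + (b\<^sup>2 + K + q\<^sup>2 / (4 * g))"
    proof -
      have "0 \<le> (2 * g * real y - q)\<^sup>2 / (4 * g)"
        using g by simp
      also have "\<dots> = g * (real y)\<^sup>2 - q * real y + q\<^sup>2 / (4 * g)"
        using g by (simp add: field_simps power2_eq_square)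
      finally show ?thesis
        by (simp add: g_def q_def power2_eq_square algebra_simps)
    qed
    finally show ?thesis
      using int by (subst nn_integral_eq_integral) (auto intro: ennreal_leI)
  qed
  moreover have "0 \<le> b\<^sup>2 + K + q\<^sup>2 / (4 * g)"
    using g V_nonneg by (simp add: K_def)
  ultimately show ?thesis
    using that by blast
qed

lemma Z_second_moment:
  obtains B where "0 \<le> B" "\<And>k. integrable M (\<lambda>\<omega>. (real (Z k \<omega>))\<^sup>2)" "\<And>k. expectation (\<lambda>\<omega>. (real (Z k \<omega>))\<^sup>2) \<le> B"
proof -
  obtain C where C: "0 \<le> C" "\<And>k y. (\<integral>\<^sup>+\<omega>. ennreal ((real (step k y \<omega>))\<^sup>2) \<partial>M) \<le> ennreal (\<alpha> * (real y)\<^sup>2 + C)"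
    using step_second_moment by blast
  \<comment> \<open>The first entry covers the initial value; the second is the fixed point of the
    recursion sending a bound \<open>B\<close> to \<open>\<alpha> * B + C\<close>.\<close>
  define B where "B = max (expectation (\<lambda>\<omega>. (real (X IY0 \<omega>))\<^sup>2)) (C / (1 - \<alpha>))"
  have B: "0 \<le> B" "\<alpha> * B + C \<le> B"
  proof -
    have "C / (1 - \<alpha>) \<le> B"
      by (simp add: B_def)
    then show "\<alpha> * B + C \<le> B"
      using alpha by (simp add: field_simps)
    have "0 \<le> C / (1 - \<alpha>)"
      using C alpha by simp
    with \<open>C / (1 - \<alpha>) \<le> B\<close> show "0 \<le> B"
      by linarith
  qed
  have nn: "(\<integral>\<^sup>+\<omega>. ennreal ((real (Z k \<omega>))\<^sup>2) \<partial>M) \<le> ennreal B" for k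
  proof (induction k)
    case 0
    show ?case
      unfolding Z_0 using Y0_L2 by (subst nn_integral_eq_integral) (auto simp: B_def intro: ennreal_leI)
  next
    case (Suc k)
    have "(\<integral>\<^sup>+\<omega>. ennreal ((real (Z (Suc k) \<omega>))\<^sup>2) \<partial>M) \<le> (\<integral>\<^sup>+\<omega>. ennreal (\<alpha> * (real (Z k \<omega>))\<^sup>2 + C) \<partial>M)"
      by (rule nn_integral_step[where g = "\<lambda>_ z. ennreal ((real z)\<^sup>2)"]) (rule C)
    also have "\<dots> = (\<integral>\<^sup>+\<omega>. ennreal \<alpha> * ennreal ((real (Z k \<omega>))\<^sup>2) + ennreal C \<partial>M)"
      using alpha C by (intro nn_integral_cong) (simp add: ennreal_mult[symmetric] ennreal_plus[symmetric] del: ennreal_plus)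
    also have "\<dots> = ennreal \<alpha> * (\<integral>\<^sup>+\<omega>. ennreal ((real (Z k \<omega>))\<^sup>2) \<partial>M) + ennreal C"
      by (subst nn_integral_add) (auto simp: nn_integral_cmult emeasure_space_1)
    also have "\<dots> \<le> ennreal \<alpha> * ennreal B + ennreal C"
      using Suc by (intro add_mono mult_left_mono) auto
    also have "\<dots> = ennreal (\<alpha> * B + C)"
      using alpha B C by (simp add: ennreal_mult ennreal_plus)
    also have "\<dots> \<le> ennreal B"
      using B by (intro ennreal_leI)
    finally show ?case .
  qed
  have int: "integrable M (\<lambda>\<omega>. (real (Z k \<omega>))\<^sup>2)" for k
    using nn[of k] by (intro integrableI_bounded) (auto intro: le_less_trans)
  have "expectation (\<lambda>\<omega>. (real (Z k \<omega>))\<^sup>2) \<le> B" for k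
    using nn[of k] int[of k] B by (subst (asm) nn_integral_eq_integral) auto
  with B int show ?thesis
    using that by blast
qed

text \<open>Chebyshev and Borel-Cantelli. The exponent 3/4 exceeds 1/2, so its double is summable
  here; it is below 1, as the strong law for the truncated summands requires.\<close>

lemma Z_eventually_small:
  "AE \<omega> in M. eventually (\<lambda>k. real (Z k \<omega>) \<le> real (Suc k) powr (3/4)) sequentially"
proof -
  obtain B where B: "0 \<le> B" "\<And>k. integrable M (\<lambda>\<omega>. (real (Z k \<omega>))\<^sup>2)" "\<And>k. expectation (\<lambda>\<omega>. (real (Z k \<omega>))\<^sup>2) \<le> B"
    using Z_second_moment by blast
  define A where "A k = {\<omega>\<in>space M. real (Suc k) powr (3/4) \<le> \<bar>real (Z k \<omega>)\<bar>}" for k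
  have [measurable]: "A k \<in> sets M" for k
    unfolding A_def by measurable
  have bound: "measure M (A k) \<le> B * real (Suc k) powr (-3/2)" for k
  proof -
    have "measure M (A k) \<le> expectation (\<lambda>\<omega>. (real (Z k \<omega>))\<^sup>2) / (real (Suc k) powr (3/4))\<^sup>2"
      unfolding A_def using B(2)[of k] by (intro second_moment_method) auto
    also have "\<dots> \<le> B / (real (Suc k) powr (3/4))\<^sup>2"
      using B(3) by (intro divide_right_mono) auto
    also have "(real (Suc k) powr (3/4))\<^sup>2 = real (Suc k) powr (3/2)"
      by (simp add: power2_eq_square powr_add[symmetric])
    finally show ?thesis
      by (simp add: powr_minus field_simps)
  qed
  have "summable (\<lambda>k. real k powr (-3/2))"
    by (simp add: summable_real_powr_iff)
  then have "summable (\<lambda>k. B * real (Suc k) powr (-3/2))"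
    by (intro summable_mult) (subst summable_Suc_iff)
  then have "summable (\<lambda>k. measure M (A k))"
    by (rule summable_comparison_test') (use bound in auto)
  then have "AE \<omega> in M. eventually (\<lambda>k. \<omega> \<in> space M - A k) sequentially"
    by (intro borel_cantelli_AE1) (auto simp: less_top[symmetric])
  then show ?thesis
    by eventually_elim (auto elim!: eventually_mono simp: A_def)
qed

section \<open>Averages along the process\<close>

text \<open>Puts zeros at the excluded times and shifts the index, giving partial sums of a full
  sequence as in \<open>strong_law\<close>.\<close>

lemma sumstar_eq_lessThan: "sumstar n s1 s2 f = (\<Sum>k<n. if Suc k \<in> {s1, s2} then 0 else f (Suc k))"
proof -
  have "sumstar n s1 s2 f = (\<Sum>k\<in>{Suc 0..n}. if k \<in> {s1, s2} then 0 else f k)"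
    unfolding sumstar_def by (intro sum.mono_neutral_cong_left) auto
  then show ?thesis
    by (simp only: sum.atLeast1_atMost_eq)
qed

text \<open>Only second moments of the process are bounded, so the summands are truncated at
  \<open>Z k \<le> (k + 1) powr (3/4)\<close>. This keeps their variances summable against \<open>1 / k\<^sup>2\<close> and almost surely
  changes only finitely many of them.\<close>

lemma strong_law_step:
  fixes \<phi> :: "nat \<Rightarrow> nat \<Rightarrow> nat \<Rightarrow> real"
  assumes mean: "\<And>k y. Suc k \<notin> {s1, s2} \<Longrightarrow> expectation (\<lambda>\<omega>. \<phi> k y (step k y \<omega>)) = 0"
    and sq: "\<And>k y. Suc k \<notin> {s1, s2} \<Longrightarrow> integrable M (\<lambda>\<omega>. (\<phi> k y (step k y \<omega>))\<^sup>2)"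
    and var: "\<And>k y. Suc k \<notin> {s1, s2} \<Longrightarrow>
      expectation (\<lambda>\<omega>. (\<phi> k y (step k y \<omega>))\<^sup>2) \<le> C * ((1 + real y) * (1 + (real y)\<^sup>2))"
  shows "AE \<omega> in M. (\<lambda>n. sumstar n s1 s2 (\<lambda>k. \<phi> (k - 1) (Z (k - 1) \<omega>) (Z k \<omega>)) / real n) \<longlonglongrightarrow> 0"
proof -
  obtain B where B: "0 \<le> B" "\<And>k. integrable M (\<lambda>\<omega>. (real (Z k \<omega>))\<^sup>2)" "\<And>k. expectation (\<lambda>\<omega>. (real (Z k \<omega>))\<^sup>2) \<le> B"
    using Z_second_moment by blast
  define L where "L k = real (Suc k) powr (3/4)" for k
  \<comment> \<open>The cut-off looks at the present value \<open>y\<close> only, never at the next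
    one, so the mean given the past stays zero.\<close>
  define \<psi> where "\<psi> k y z = (if Suc k \<in> {s1, s2} \<or> L k < real y then 0 else \<phi> k y z)" for k y z
  define D where "D k \<omega> = \<psi> k (Z k \<omega>) (Z (Suc k) \<omega>)" for k \<omega>
  define F where "F k = gen_sigma M X (past k)" for k
  have L1: "1 \<le> L k" for k
    by (simp add: L_def ge_one_powr_ge_zero)
  have C: "0 \<le> C"
  proof -
    \<comment> \<open>The time \<open>s1 + s2 + 1\<close> is not an outlier time, and at
      \<open>y = 0\<close> the growth factor in \<open>var\<close> is 1.\<close>
    have "0 \<le> expectation (\<lambda>\<omega>. (\<phi> (s1 + s2) 0 (step (s1 + s2) 0 \<omega>))\<^sup>2)"
      by simp
    also have "\<dots> \<le> C"
      using var[of "s1 + s2" 0] by simp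
    finally show ?thesis .
  qed
  have \<psi>_meas: "(\<lambda>\<omega>. \<psi> k y (step k y \<omega>)) \<in> borel_measurable N"
    if "step k y \<in> measurable N (count_space UNIV)" for k y N
    by (rule measurable_compose[OF that]) simp
  have \<psi>_sq: "integrable M (\<lambda>\<omega>. (\<psi> k y (step k y \<omega>))\<^sup>2)" for k y
    using sq[of k y] by (cases "Suc k \<in> {s1, s2} \<or> L k < real y") (auto simp: \<psi>_def)
  have \<psi>_mean: "expectation (\<lambda>\<omega>. \<psi> k y (step k y \<omega>)) = 0" for k y
    using mean[of k y] by (cases "Suc k \<in> {s1, s2} \<or> L k < real y") (auto simp: \<psi>_def)
  have \<psi>_int: "integrable M (\<lambda>\<omega>. \<psi> k y (step k y \<omega>))" for k y
    by (rule square_integrable_imp_integrable[OF _ \<psi>_sq]) (intro \<psi>_meas step_meas)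
  have \<psi>_var: "expectation (\<lambda>\<omega>. (\<psi> k y (step k y \<omega>))\<^sup>2) \<le> 2 * C * L k * (1 + (real y)\<^sup>2)" for k y
  proof (cases "Suc k \<in> {s1, s2} \<or> L k < real y")
    case True
    then show ?thesis
      using C L1[of k] by (auto simp: \<psi>_def)
  next
    case False
    then have "expectation (\<lambda>\<omega>. (\<psi> k y (step k y \<omega>))\<^sup>2) \<le> C * ((1 + real y) * (1 + (real y)\<^sup>2))"
      using var[of k y] by (simp add: \<psi>_def)
    \<comment> \<open>On the retained range \<open>1 + y \<le> 2 * L k\<close>. Giving up this
      factor leaves a second moment, which is bounded along the process.\<close>
    also have "\<dots> \<le> C * ((2 * L k) * (1 + (real y)\<^sup>2))"
      using False L1[of k] C by (intro mult_left_mono mult_right_mono) auto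
    finally show ?thesis
      by (simp add: mult_ac)
  qed
  have D_meas: "D k \<in> borel_measurable (F (Suc k))" for k
  proof -
    have Zm: "Z k \<in> measurable (F (Suc k)) (count_space UNIV)"
      unfolding F_def by (rule gen_sigma_mono[OF Z_past]) (simp add: past_Suc)
    have "(\<lambda>\<omega>. \<psi> k y (Z (Suc k) \<omega>)) \<in> borel_measurable (F (Suc k))" for y
      unfolding F_def by (rule measurable_compose[OF Z_past]) simp
    then show ?thesis
      unfolding D_def[abs_def] by (rule measurable_compose_countable[OF _ Zm])
  qed
  have sub: "subalgebra M (F k)" for k
    unfolding F_def by (rule subalg[OF past_sub])
  have [measurable]: "D k \<in> borel_measurable M" for k
    using measurable_from_subalg[OF sub D_meas] .
  have nn: "(\<integral>\<^sup>+\<omega>. ennreal ((D k \<omega>)\<^sup>2) \<partial>M) \<le> ennreal (2 * C * L k * (1 + B))" for k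
  proof -
    have "(\<integral>\<^sup>+\<omega>. ennreal ((D k \<omega>)\<^sup>2) \<partial>M) \<le> (\<integral>\<^sup>+\<omega>. ennreal (2 * C * L k * (1 + (real (Z k \<omega>))\<^sup>2)) \<partial>M)"
      unfolding D_def
    proof (rule nn_integral_step[where g = "\<lambda>y z. ennreal ((\<psi> k y z)\<^sup>2)"])
      show "(\<integral>\<^sup>+\<omega>. ennreal ((\<psi> k y (step k y \<omega>))\<^sup>2) \<partial>M) \<le> ennreal (2 * C * L k * (1 + (real y)\<^sup>2))" for y
        using \<psi>_sq[of k y] \<psi>_var[of k y] by (subst nn_integral_eq_integral) (auto intro: ennreal_leI)
    qed
    also have "\<dots> = ennreal (expectation (\<lambda>\<omega>. 2 * C * L k * (1 + (real (Z k \<omega>))\<^sup>2)))"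
      using B(2)[of k] C L1[of k] by (intro nn_integral_eq_integral) auto
    also have "\<dots> \<le> ennreal (2 * C * L k * (1 + B))"
      using B C L1[of k] by (intro ennreal_leI) (auto simp: prob_space intro!: mult_left_mono)
    finally show ?thesis .
  qed
  have D_sq: "integrable M (\<lambda>\<omega>. (D k \<omega>)\<^sup>2)" for k
    using nn[of k] by (intro integrableI_bounded) (auto intro: le_less_trans)
  have D_var: "expectation (\<lambda>\<omega>. (D k \<omega>)\<^sup>2) \<le> 2 * C * (1 + B) * real (Suc k) powr (3/4)" for k
  proof -
    have "ennreal (expectation (\<lambda>\<omega>. (D k \<omega>)\<^sup>2)) \<le> ennreal (2 * C * L k * (1 + B))"
      using nn[of k] D_sq[of k] by (subst (asm) nn_integral_eq_integral) auto
    then have "expectation (\<lambda>\<omega>. (D k \<omega>)\<^sup>2) \<le> 2 * C * L k * (1 + B)"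
      using B C L1[of k] by (subst (asm) ennreal_le_iff) auto
    then show ?thesis
      unfolding L_def by (simp only: mult_ac)
  qed
  have orth: "expectation (\<lambda>\<omega>. f \<omega> * D k \<omega>) = 0"
    if f: "f \<in> borel_measurable (F k)" and f2: "integrable M (\<lambda>\<omega>. (f \<omega>)\<^sup>2)" for k f
  proof -
    have [measurable]: "f \<in> borel_measurable M"
      using measurable_from_subalg[OF sub f] .
    have fint: "integrable M f"
      using square_integrable_imp_integrable[OF _ f2] by simp
    \<comment> \<open>The truncation leaves finitely many present values \<open>y \<le> N\<close>,
      so \<open>f * D k\<close> is a finite sum. In each term, \<open>f\<close> restricted to
      \<open>Z k = y\<close> is a function of the past, independent of the centred
      \<open>\<psi> k y (step k y \<omega>)\<close>.\<close>
    define N where "N = nat \<lfloor>L k\<rfloor>"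
    define a where "a y \<omega> = f \<omega> * indicator {y} (Z k \<omega>)" for y \<omega>
    have a_meas: "a y \<in> borel_measurable (gen_sigma M X (past k))" for y
      unfolding a_def[abs_def]
      using f unfolding F_def by (intro borel_measurable_times measurable_compose[OF Z_past]) auto
    have a_int: "integrable M (a y)" for y
      by (rule Bochner_Integration.integrable_bound[OF fint])
        (auto simp: a_def indicator_def intro: measurable_from_subalg[OF subalg[OF past_sub] a_meas])
    have ind: "indep_var borel (a y) borel (\<lambda>\<omega>. \<psi> k y (step k y \<omega>))" for y
      by (rule indep_var_gen_sigma[OF indep_idx past_sub fut_sub past_fut a_meas \<psi>_meas[OF step_fut]])
    have zero: "expectation (\<lambda>\<omega>. a y \<omega> * \<psi> k y (step k y \<omega>)) = 0"
      and int: "integrable M (\<lambda>\<omega>. a y \<omega> * \<psi> k y (step k y \<omega>))" for y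
      using indep_var_lebesgue_integral[OF ind a_int \<psi>_int] indep_var_integrable[OF ind a_int \<psi>_int] \<psi>_mean
      by auto
    have "f \<omega> * D k \<omega> = (\<Sum>y\<le>N. a y \<omega> * \<psi> k y (step k y \<omega>))" for \<omega>
    proof (cases "Z k \<omega> \<le> N")
      case True
      have "(\<Sum>y\<le>N. a y \<omega> * \<psi> k y (step k y \<omega>))
          = (\<Sum>y\<le>N. if y = Z k \<omega> then f \<omega> * \<psi> k y (step k y \<omega>) else 0)"
        by (intro sum.cong) (auto simp: a_def)
      then show ?thesis
        using True by (simp add: D_def Z_Suc)
    next
      case False
      then have "L k < real (Z k \<omega>)"
        unfolding N_def by linarith
      moreover have "(\<Sum>y\<le>N. a y \<omega> * \<psi> k y (step k y \<omega>)) = 0"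
        using False by (intro sum.neutral) (auto simp: a_def)
      ultimately show ?thesis
        by (simp add: D_def \<psi>_def)
    qed
    then show ?thesis
      using int zero by (simp add: Bochner_Integration.integral_sum)
  qed
  interpret mart_diff M F D
  proof
    show "sets (F k) \<subseteq> sets (F (Suc k))" for k
      unfolding F_def by (rule sets_gen_sigma_mono) (simp add: past_Suc)
  qed (fact sub D_meas D_sq orth)+
  have "AE \<omega> in M. (\<lambda>n. (\<Sum>k<n. D k \<omega>) / real n) \<longlonglongrightarrow> 0"
    by (rule strong_law[OF D_var]) auto
  then show ?thesis
    using Z_eventually_small
  proof eventually_elim
    case (elim \<omega>)
    \<comment> \<open>The effect of the truncation. It vanishes from \<open>K\<close> on, so its
      partial sums are eventually constant and disappear after division by \<open>n\<close>.\<close>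
    define d where "d k = (if Suc k \<in> {s1, s2} then 0 else \<phi> k (Z k \<omega>) (Z (Suc k) \<omega>)) - D k \<omega>" for k
    obtain K where K: "\<And>k. K \<le> k \<Longrightarrow> real (Z k \<omega>) \<le> L k"
      using elim(2) by (auto simp: eventually_sequentially L_def)
    have d0: "d k = 0" if "K \<le> k" for k
      using K[OF that] by (simp add: d_def D_def \<psi>_def)
    have "eventually (\<lambda>n. (\<Sum>k<K. d k) / real n + (\<Sum>k<n. D k \<omega>) / real n
        = sumstar n s1 s2 (\<lambda>k. \<phi> (k - 1) (Z (k - 1) \<omega>) (Z k \<omega>)) / real n) sequentially"
      using eventually_ge_at_top[of K]
    proof eventually_elim
      case (elim n)
      have "(\<Sum>k<K. d k) = (\<Sum>k<n. d k)"
        using elim d0 by (intro sum.mono_neutral_left) auto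
      moreover have "sumstar n s1 s2 (\<lambda>k. \<phi> (k - 1) (Z (k - 1) \<omega>) (Z k \<omega>))
          = (\<Sum>k<n. if Suc k \<in> {s1, s2} then 0 else \<phi> k (Z k \<omega>) (Z (Suc k) \<omega>))"
        unfolding sumstar_eq_lessThan by (intro sum.cong) auto
      ultimately show ?case
        by (simp add: d_def sum_subtractf add_divide_distrib[symmetric])
    qed
    moreover have "(\<lambda>n. (\<Sum>k<K. d k) / real n + (\<Sum>k<n. D k \<omega>) / real n) \<longlonglongrightarrow> 0 + 0"
      by (intro tendsto_add elim(1) lim_const_over_n)
    ultimately show ?case
      by (simp add: tendsto_cong)
  qed
qed

section \<open>How often the path moves, and the three averages\<close>

definition \<delta> :: real where
  "\<delta> = min (min \<alpha> (1 - \<alpha>)) (prob {\<omega> \<in> space M. X (IEps 1) \<omega> \<noteq> 0})"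

lemma delta_pos: "0 < \<delta>"
  using alpha eps_nz by (simp add: \<delta>_def)

text \<open>From 0, any nonzero innovation is a move. From \<open>y \<ge> 1\<close>, one Bernoulli
  variable \<open>x\<close> is singled out: given the rest \<open>R\<close>, at most one value of
  \<open>x\<close> keeps the state, so staying has probability at most
  \<open>max \<alpha> (1 - \<alpha>)\<close>.\<close>

lemma move_probability:
  assumes "Suc k \<notin> {s1, s2}"
  shows "\<delta> \<le> prob {\<omega> \<in> space M. step k y \<omega> \<noteq> y}"
proof (cases y)
  case 0
  have m: "X (IEps (Suc j)) \<in> measurable M (count_space UNIV)" for j
    by (rule X_meas[OF eps_idx])
  have "measure (distr M (count_space UNIV) (X (IEps (Suc k)))) {0<..}
      = measure (distr M (count_space UNIV) (X (IEps 1))) {0<..}"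
    using eps_id[of "Suc k"] by simp
  then have "prob {\<omega> \<in> space M. X (IEps (Suc k)) \<omega> \<noteq> 0} = prob {\<omega> \<in> space M. X (IEps 1) \<omega> \<noteq> 0}"
    using m[of k] m[of 0] by (simp add: measure_distr vimage_def Int_def conj_commute)
  moreover have "step k 0 \<omega> = X (IEps (Suc k)) \<omega>" for \<omega>
    using assms by (simp add: step_def out_def)
  ultimately show ?thesis
    using 0 by (simp add: \<delta>_def)
next
  case (Suc n)
  define R where "R \<omega> = (\<Sum>j=2..y. X (IXi (Suc k) j) \<omega>) + X (IEps (Suc k)) \<omega>" for \<omega>
  define x where "x = X (IXi (Suc k) 1)"
  have "{1..y} = insert 1 {2..y}"
    using Suc by auto
  then have step: "step k y \<omega> = x \<omega> + R \<omega>" for \<omega>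
    using assms by (simp add: step_def out_def R_def x_def)
  let ?A = "{IXi (Suc k) 1}" and ?B = "insert (IEps (Suc k)) {IXi (Suc k) j | j. 2 \<le> j}"
  have AB: "?A \<subseteq> idx" "?B \<subseteq> idx" "?A \<inter> ?B = {}"
    by (auto simp: idx_def)
  have xA: "x \<in> measurable (gen_sigma M X ?A) (count_space UNIV)"
    unfolding x_def by (rule measurable_gen_sigma) simp
  have RB: "R \<in> measurable (gen_sigma M X ?B) (count_space UNIV)"
  proof -
    have [measurable]: "X (IEps (Suc k)) \<in> measurable (gen_sigma M X ?B) (count_space UNIV)"
      by (rule measurable_gen_sigma) simp
    show ?thesis
      unfolding R_def[abs_def] by measurable (auto intro!: measurable_gen_sigma)
  qed
  have [measurable]: "x \<in> measurable M (count_space UNIV)" "R \<in> measurable M (count_space UNIV)"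
    using measurable_from_subalg[OF subalg xA] measurable_from_subalg[OF subalg RB] AB by auto
  have prod: "prob ({\<omega> \<in> space M. x \<omega> = i} \<inter> {\<omega> \<in> space M. R \<omega> = r})
      = prob {\<omega> \<in> space M. x \<omega> = i} * prob {\<omega> \<in> space M. R \<omega> = r}" for i r
  proof -
    have "{\<omega> \<in> space M. x \<omega> = i} \<in> sets (gen_sigma M X ?A)" "{\<omega> \<in> space M. R \<omega> = r} \<in> sets (gen_sigma M X ?B)"
      using measurable_sets[OF xA, of "{i}"] measurable_sets[OF RB, of "{r}"]
      by (simp_all add: vimage_def Int_def conj_commute)
    then show ?thesis
      using indep_set_gen_sigma[OF indep_idx AB] unfolding indep_sets2_eq by blast
  qed
  have x1: "prob {\<omega> \<in> space M. x \<omega> = 1} = \<alpha>"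
    using bern[of "Suc k" 1] by (simp add: x_def)
  have x01: "x \<omega> = 0 \<or> x \<omega> = 1" if "\<omega> \<in> space M" for \<omega>
    using bern01[of "Suc k" 1 \<omega>] that unfolding x_def by linarith
  have x0: "prob {\<omega> \<in> space M. x \<omega> = 0} = 1 - \<alpha>"
  proof -
    have "{\<omega> \<in> space M. x \<omega> = 0} = space M - {\<omega> \<in> space M. x \<omega> = 1}"
      using x01 by auto
    then show ?thesis
      using x1 by (simp add: prob_compl)
  qed
  define m where "m = max \<alpha> (1 - \<alpha>)"
  have "step k y \<omega> = y \<longleftrightarrow> x \<omega> = 1 \<and> R \<omega> = n \<or> x \<omega> = 0 \<and> R \<omega> = y" if "\<omega> \<in> space M" for \<omega>
    unfolding step using x01[OF that] Suc by auto
  then have "{\<omega> \<in> space M. step k y \<omega> = y}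
      = ({\<omega> \<in> space M. x \<omega> = 1} \<inter> {\<omega> \<in> space M. R \<omega> = n}) \<union> ({\<omega> \<in> space M. x \<omega> = 0} \<inter> {\<omega> \<in> space M. R \<omega> = y})"
    by auto
  then have "prob {\<omega> \<in> space M. step k y \<omega> = y}
      = \<alpha> * prob {\<omega> \<in> space M. R \<omega> = n} + (1 - \<alpha>) * prob {\<omega> \<in> space M. R \<omega> = y}"
    by (simp only:) (subst finite_measure_Union, auto simp: prod x0 x1[simplified])
  also have "\<dots> \<le> m * prob {\<omega> \<in> space M. R \<omega> = n} + m * prob {\<omega> \<in> space M. R \<omega> = y}"
    by (intro add_mono mult_right_mono) (auto simp: m_def)
  \<comment> \<open>Since \<open>y = n + 1\<close>, the two events for \<open>R\<close> are
    disjoint, so their probabilities add up to at most 1.\<close>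
  also have "\<dots> = m * prob ({\<omega> \<in> space M. R \<omega> = n} \<union> {\<omega> \<in> space M. R \<omega> = y})"
    using Suc by (subst finite_measure_Union) (auto simp: distrib_left)
  also have "\<dots> \<le> m"
    using alpha by (intro mult_left_le) (auto simp: m_def)
  finally have "prob {\<omega> \<in> space M. step k y \<omega> = y} \<le> m" .
  moreover have "{\<omega> \<in> space M. step k y \<omega> \<noteq> y} = space M - {\<omega> \<in> space M. step k y \<omega> = y}"
    by auto
  ultimately have "1 - m \<le> prob {\<omega> \<in> space M. step k y \<omega> \<noteq> y}"
    by (simp add: prob_compl)
  then show ?thesis
    by (simp add: \<delta>_def m_def)
qed

lemma residual_average:
  "AE \<omega> in M. (\<lambda>n. sumstar n s1 s2 (\<lambda>k. real (Z k \<omega>) - \<alpha> * real (Z (k - 1) \<omega>) - \<mu>) / real n) \<longlonglongrightarrow> 0"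
proof (rule strong_law_step[where \<phi> = "\<lambda>k y z. real z - \<alpha> * real y - \<mu>" and C = "2 + 2 * V"])
  fix k y assume k: "Suc k \<notin> {s1, s2}"
  have eq: "(\<lambda>\<omega>. real (step k y \<omega>) - \<alpha> * real y - \<mu>) = noise k y"
    using k by (intro ext) (simp add: step_eq_noise out_def)
  then have eq2: "(\<lambda>\<omega>. (real (step k y \<omega>) - \<alpha> * real y - \<mu>)\<^sup>2) = (\<lambda>\<omega>. (noise k y \<omega>)\<^sup>2)"
    by (metis (no_types))
  show "expectation (\<lambda>\<omega>. real (step k y \<omega>) - \<alpha> * real y - \<mu>) = 0"
    unfolding eq by (rule noise_moments)
  show "integrable M (\<lambda>\<omega>. (real (step k y \<omega>) - \<alpha> * real y - \<mu>)\<^sup>2)"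
    unfolding eq2 by (rule noise_moments)
  have "(1 + real y) * 1 \<le> (1 + real y) * (1 + (real y)\<^sup>2)"
    by (intro mult_left_mono) auto
  then show "expectation (\<lambda>\<omega>. (real (step k y \<omega>) - \<alpha> * real y - \<mu>)\<^sup>2) \<le> (2 + 2 * V) * ((1 + real y) * (1 + (real y)\<^sup>2))"
    unfolding eq2 using V_nonneg
    by (intro order_trans[OF noise_moments(5)] mult_left_mono) auto
qed

text \<open>The square of the lagged factor times the linear variance of the noise is of third order
  in \<open>y\<close>, exactly the growth that \<open>strong_law_step\<close> admits.\<close>

lemma cross_average:
  "AE \<omega> in M. (\<lambda>n. sumstar n s1 s2 (\<lambda>k. real (Z (k - 1) \<omega>)
    * (real (Z k \<omega>) - \<alpha> * real (Z (k - 1) \<omega>) - \<mu>)) / real n) \<longlonglongrightarrow> 0"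
proof (rule strong_law_step[where \<phi> = "\<lambda>k y z. real y * (real z - \<alpha> * real y - \<mu>)" and C = "2 + 2 * V"])
  fix k y assume k: "Suc k \<notin> {s1, s2}"
  have eq: "(\<lambda>\<omega>. real y * (real (step k y \<omega>) - \<alpha> * real y - \<mu>)) = (\<lambda>\<omega>. real y * noise k y \<omega>)"
    using k by (intro ext) (simp add: step_eq_noise out_def)
  have eq2: "(\<lambda>\<omega>. (real y * (real (step k y \<omega>) - \<alpha> * real y - \<mu>))\<^sup>2) = (\<lambda>\<omega>. (real y)\<^sup>2 * (noise k y \<omega>)\<^sup>2)"
    using k by (intro ext) (simp add: step_eq_noise out_def power_mult_distrib)
  show "expectation (\<lambda>\<omega>. real y * (real (step k y \<omega>) - \<alpha> * real y - \<mu>)) = 0"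
    unfolding eq using noise_moments[of k y] by simp
  show "integrable M (\<lambda>\<omega>. (real y * (real (step k y \<omega>) - \<alpha> * real y - \<mu>))\<^sup>2)"
    unfolding eq2 using noise_moments[of k y] by simp
  have "expectation (\<lambda>\<omega>. (real y)\<^sup>2 * (noise k y \<omega>)\<^sup>2) \<le> (1 + (real y)\<^sup>2) * ((2 + 2 * V) * (1 + real y))"
    using noise_moments(5)[of k y] by (simp del: distrib_left_numeral) (intro mult_mono, auto)
  then show "expectation (\<lambda>\<omega>. (real y * (real (step k y \<omega>) - \<alpha> * real y - \<mu>))\<^sup>2)
      \<le> (2 + 2 * V) * ((1 + real y) * (1 + (real y)\<^sup>2))"
    unfolding eq2 by (simp only: mult_ac)
qed

text \<open>The move indicators minus their conditional probabilities \<open>p\<close> average to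
  zero, and these probabilities are at least \<open>\<delta>\<close> at every non-outlier
  time.\<close>

lemma moves_frequent:
  "AE \<omega> in M. eventually (\<lambda>n. \<delta> / 2 * real n
    \<le> sumstar n s1 s2 (\<lambda>k. if Z k \<omega> \<noteq> Z (k - 1) \<omega> then 1 else 0)) sequentially"
proof -
  define p where "p k y = prob {\<omega> \<in> space M. step k y \<omega> \<noteq> y}" for k y
  have p01: "0 \<le> p k y" "p k y \<le> 1" for k y
    by (simp_all add: p_def)
  have "AE \<omega> in M. (\<lambda>n. sumstar n s1 s2 (\<lambda>k. (if Z k \<omega> \<noteq> Z (k - 1) \<omega> then 1 else 0)
      - p (k - 1) (Z (k - 1) \<omega>)) / real n) \<longlonglongrightarrow> 0"
  proof (rule strong_law_step[where \<phi> = "\<lambda>k y z. (if z \<noteq> y then 1 else 0) - p k y" and C = 1])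
    fix k y
    define h where "h \<omega> = (if step k y \<omega> \<noteq> y then 1 else 0 :: real)" for \<omega>
    have [measurable]: "h \<in> borel_measurable M"
      unfolding h_def[abs_def] by (rule measurable_compose[OF step_meas]) simp
    have h_int: "integrable M h"
      by (rule integrable_const_bound[of _ 1]) (auto simp: h_def)
    have "expectation h = expectation (indicator {\<omega> \<in> space M. step k y \<omega> \<noteq> y})"
      by (intro Bochner_Integration.integral_cong) (auto simp: h_def indicator_def)
    then have Eh: "expectation h = p k y"
      by (simp add: p_def)
    then show "expectation (\<lambda>\<omega>. (if step k y \<omega> \<noteq> y then 1 else 0) - p k y) = 0"
      using h_int by (simp add: prob_space flip: h_def)
    have b: "((if z \<noteq> y then 1 else 0) - p k y)\<^sup>2 \<le> 1" for z
      using p01[of k y] by (auto simp: abs_square_le_1)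
    show i: "integrable M (\<lambda>\<omega>. ((if step k y \<omega> \<noteq> y then 1 else 0) - p k y)\<^sup>2)"
      unfolding h_def[symmetric]
      by (rule integrable_const_bound[of _ 1]) (use b in \<open>auto simp: h_def intro!: AE_I2\<close>)
    have "expectation (\<lambda>\<omega>. ((if step k y \<omega> \<noteq> y then 1 else 0) - p k y)\<^sup>2) \<le> 1"
      using integral_mono[OF i integrable_const[of 1] b] by (simp add: prob_space)
    also have "1 \<le> 1 * ((1 + real y) * (1 + (real y)\<^sup>2))"
      using mult_mono[of 1 "1 + real y" 1 "1 + (real y)\<^sup>2"] by simp
    finally show "expectation (\<lambda>\<omega>. ((if step k y \<omega> \<noteq> y then 1 else 0) - p k y)\<^sup>2)
        \<le> 1 * ((1 + real y) * (1 + (real y)\<^sup>2))" .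
  qed
  then show ?thesis
  proof eventually_elim
    case (elim \<omega>)
    define A where "A n = sumstar n s1 s2 (\<lambda>k. (if Z k \<omega> \<noteq> Z (k - 1) \<omega> then 1 else 0) - p (k - 1) (Z (k - 1) \<omega>))" for n
    have "(\<lambda>n. A n / real n) \<longlonglongrightarrow> 0"
      using elim by (simp add: A_def)
    \<comment> \<open>A quarter of \<open>\<delta> * n\<close> is given away here and another in
      \<open>n - 2 \<ge> 3 / 4 * n\<close>, valid for \<open>n \<ge> 8\<close>; one half
      remains.\<close>
    then have "eventually (\<lambda>n. - (\<delta> / 4) < A n / real n) sequentially"
      by (rule order_tendstoD) (use delta_pos in simp)
    then show ?case
      using eventually_ge_at_top[of "max (max s1 s2) 8"]
    proof eventually_elim
      case (elim n)
      then have n: "s1 \<le> n" "s2 \<le> n" and "8 \<le> n"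
        by auto
      have "- (1 / 4) * (\<delta> * real n) \<le> A n"
        using elim \<open>8 \<le> n\<close> by (simp add: field_simps)
      moreover have "(real n - 2) * \<delta> \<le> sumstar n s1 s2 (\<lambda>k. p (k - 1) (Z (k - 1) \<omega>))"
      proof -
        have "(real n - 2) * \<delta> = sumstar n s1 s2 (\<lambda>k. \<delta>)"
          by (rule sumstar_const[OF s n, symmetric])
        also have "\<dots> \<le> sumstar n s1 s2 (\<lambda>k. p (k - 1) (Z (k - 1) \<omega>))"
          unfolding sumstar_def p_def by (intro sum_mono move_probability) auto
        finally show ?thesis .
      qed
      moreover have "3 / 4 * (\<delta> * real n) \<le> (real n - 2) * \<delta>"
        using mult_right_mono[of "3 / 4 * real n" "real n - 2" \<delta>] \<open>8 \<le> n\<close> delta_pos by (simp add: mult_ac)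
      moreover have "A n = sumstar n s1 s2 (\<lambda>k. if Z k \<omega> \<noteq> Z (k - 1) \<omega> then 1 else 0)
          - sumstar n s1 s2 (\<lambda>k. p (k - 1) (Z (k - 1) \<omega>))"
        unfolding A_def by (rule sumstar_diff)
      ultimately show ?case
        by linarith
    qed
  qed
qed

end

section \<open>From the almost sure averages to the estimators\<close>

theorem theorem4p5p1:
  fixes M :: "'w measure" and X :: "inar_idx \<Rightarrow> 'w \<Rightarrow> nat"
    and \<alpha> :: real and s1 s2 \<theta>1 \<theta>2 :: nat
    and Y :: "'w \<Rightarrow> nat \<Rightarrow> real"
  assumes "prob_space M"
    and "0 < \<alpha>" "\<alpha> < 1"
    and "1 \<le> s1" "1 \<le> s2" "s1 \<noteq> s2" "1 \<le> \<theta>1" "1 \<le> \<theta>2"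
    and indep: "prob_space.indep_vars M (\<lambda>_. count_space UNIV) X
           ({IY0} \<union> {IEps k | k. 1 \<le> k} \<union> {IXi k j | k j. 1 \<le> k \<and> 1 \<le> j})"
    and bern01: "\<And>k j \<omega>. 1 \<le> k \<Longrightarrow> 1 \<le> j \<Longrightarrow> \<omega> \<in> space M \<Longrightarrow> X (IXi k j) \<omega> \<le> 1"
    and bern: "\<And>k j. 1 \<le> k \<Longrightarrow> 1 \<le> j \<Longrightarrow> measure M {\<omega> \<in> space M. X (IXi k j) \<omega> = 1} = \<alpha>"
    and eps_id: "\<And>k. 1 \<le> k \<Longrightarrow>
           distr M (count_space UNIV) (X (IEps k)) = distr M (count_space UNIV) (X (IEps 1))"
    and eps_L2: "integrable M (\<lambda>\<omega>. (real (X (IEps 1) \<omega>))\<^sup>2)"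
    and eps_nz: "measure M {\<omega> \<in> space M. X (IEps 1) \<omega> \<noteq> 0} > 0"
    and Y0_L2: "integrable M (\<lambda>\<omega>. (real (X IY0 \<omega>))\<^sup>2)"
    and Y_def: "Y = (\<lambda>\<omega> k. real (inarY (\<lambda>k j. X (IXi k j) \<omega>) (\<lambda>k. X (IEps k) \<omega>) (X IY0 \<omega>)
                                  s1 s2 \<theta>1 \<theta>2 k))"
  shows "AE \<omega> in M.
           (\<exists>n0. \<forall>n\<ge>n0.
              (\<forall>q. Qn n s1 s2 (Y \<omega>)
                     (alpha_hat n s1 s2 (Y \<omega>), mu_hat n s1 s2 (Y \<omega>),
                      theta_hat n s1 s2 (Y \<omega>) s1, theta_hat n s1 s2 (Y \<omega>) s2)
                   \<le> Qn n s1 s2 (Y \<omega>) q)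
            \<and> (\<forall>p. (\<forall>q. Qn n s1 s2 (Y \<omega>) p \<le> Qn n s1 s2 (Y \<omega>) q) \<longrightarrow>
                   p = (alpha_hat n s1 s2 (Y \<omega>), mu_hat n s1 s2 (Y \<omega>),
                        theta_hat n s1 s2 (Y \<omega>) s1, theta_hat n s1 s2 (Y \<omega>) s2)))
         \<and> (\<lambda>n. alpha_hat n s1 s2 (Y \<omega>)) \<longlonglongrightarrow> \<alpha>
         \<and> (\<lambda>n. mu_hat n s1 s2 (Y \<omega>)) \<longlonglongrightarrow> integral\<^sup>L M (\<lambda>\<omega>. real (X (IEps 1) \<omega>))
         \<and> (\<lambda>n. theta_hat n s1 s2 (Y \<omega>) s1) \<longlonglongrightarrow>
              Y \<omega> s1 - \<alpha> * Y \<omega> (s1 - 1) - integral\<^sup>L M (\<lambda>\<omega>. real (X (IEps 1) \<omega>))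
         \<and> (\<lambda>n. theta_hat n s1 s2 (Y \<omega>) s2) \<longlonglongrightarrow>
              Y \<omega> s2 - \<alpha> * Y \<omega> (s2 - 1) - integral\<^sup>L M (\<lambda>\<omega>. real (X (IEps 1) \<omega>))"
proof -
  interpret inar M X \<alpha> s1 s2 \<theta>1 \<theta>2
    by (rule inar.intro[OF assms(1)], unfold_locales) (fact assms)+
  have Y: "Y \<omega> = (\<lambda>k. real (Z k \<omega>))" for \<omega>
    by (simp add: Y_def Z_def)
  show ?thesis
    \<comment> \<open>The three averages hold together outside one null set; the remaining argument
      concerns a single path.\<close>
    using residual_average cross_average moves_frequent
  proof eventually_elim
    case (elim \<omega>)
    have "0 < \<delta> / 2"
      using delta_pos by simp
    note conv = estimators_converge[OF s alpha(2) elim(1,2) this elim(3)]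
    obtain n1 where n1: "\<And>n. n1 \<le> n \<Longrightarrow> 0 < Dn n s1 s2 (\<lambda>k. real (Z k \<omega>))"
      using conv(1) by (auto simp: eventually_sequentially)
    show ?case
      unfolding Y \<mu>_def[symmetric]
    \<comment> \<open>The witness lies beyond both outlier times, makes \<open>Dn\<close> positive
      through \<open>n1\<close>, and ensures \<open>n > 2\<close>.\<close>
    proof (rule conjI[OF exI[of _ "max (max s1 s2) (max n1 3)"]], goal_cases)
      case 1
      show ?case
        by (intro allI impI) (rule Qn_unique_minimizer[OF s _ _ n1], simp_all)
    next
      case 2
      show ?case
        by (intro conjI conv)
    qed
  qed
qed

end
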